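(* Let $\mathbb D=\{|z|<1\}$ and let $f:\overline{\mathbb D}\to\overline{\mathbb D}$ be a homeomorphism onto $\overline{\mathbb D}$ which is harmonic in $\mathbb D$ and $\mathscr C^1$-smooth on $\overline{\mathbb D}$. Then $$\int_{\partial\mathbb D}|\det Df|\,|dz|\;\geqslant\;\iint_{\mathbb D}|Df|^2\;\geqslant\;2\iint_{\mathbb D}|\det Df|=2\pi .$$ The first inequality is strict unless $f$ is an isometry.
   Context: $|Df|^2$ denotes the squared Hilbert–Schmidt norm of the differential, $|Df|^2=2(|f_z|^2+|f_{\bar z}|^2)$, and $\det Df=|f_z|^2-|f_{\bar z}|^2$ is the Jacobian determinant; integrals over $\mathbb D$ are with respect to area measure. *)

theory Defs
  imports "HOL-Analysis.Analysis"
begin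

text \<open>Wirtinger derivatives of a real-linear map L on the complex plane:
  L h = fz L * h + fzbar L * cnj h.\<close>
definition wirt_z :: "(complex \<Rightarrow>\<^sub>L complex) \<Rightarrow> complex" where
  "wirt_z L = (blinfun_apply L 1 - \<i> * blinfun_apply L \<i>) / 2"

definition wirt_zbar :: "(complex \<Rightarrow>\<^sub>L complex) \<Rightarrow> complex" where
  "wirt_zbar L = (blinfun_apply L 1 + \<i> * blinfun_apply L \<i>) / 2"

definition hs_norm2 :: "(complex \<Rightarrow>\<^sub>L complex) \<Rightarrow> real" where
  "hs_norm2 L = 2 * ((cmod (wirt_z L))\<^sup>2 + (cmod (wirt_zbar L))\<^sup>2)"

definition jac_det :: "(complex \<Rightarrow>\<^sub>L complex) \<Rightarrow> real" where
  "jac_det L = (cmod (wirt_z L))\<^sup>2 - (cmod (wirt_zbar L))\<^sup>2"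

definition harmonic_on :: "(complex \<Rightarrow> complex) \<Rightarrow> complex set \<Rightarrow> bool" where
  "harmonic_on f S \<longleftrightarrow> open S \<and>
     (\<exists>D1 :: complex \<Rightarrow> (complex \<Rightarrow>\<^sub>L complex).
      \<exists>D2 :: complex \<Rightarrow> (complex \<Rightarrow>\<^sub>L (complex \<Rightarrow>\<^sub>L complex)).
        (\<forall>z\<in>S. (f has_derivative blinfun_apply (D1 z)) (at z)) \<and>
        (\<forall>z\<in>S. (D1 has_derivative blinfun_apply (D2 z)) (at z)) \<and>
        continuous_on S D2 \<and>
        (\<forall>z\<in>S. blinfun_apply (blinfun_apply (D2 z) 1) 1
                + blinfun_apply (blinfun_apply (D2 z) \<i>) \<i> = 0))"

end

theory Submission
  imports Defs "HOL-Complex_Analysis.Complex_Analysis"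
begin

text \<open>
  On the unit circle write \<open>f(cis t) = cis (\<phi> t)\<close> with \<open>\<phi>\<close> monotone (say increasing), and let
  \<open>u\<close> be the inner product of \<open>f\<close> with its radial derivative. There the Jacobian is \<open>\<phi>' u\<close>, while by
  Green's formula the energy is the integral of \<open>u\<close>; so the first inequality says that the integral of
  \<open>(\<phi>' - 1) u\<close> is nonnegative. By the Poisson formula \<open>u(t)\<close> is, up to a constant, the integral over
  \<open>h\<close> of \<open>(1 - cos \<Phi>) / (1 - cos h)\<close> with \<open>\<Phi> = \<phi>(t + h) - \<phi>(t)\<close>. Replacing \<open>\<phi>'(t)\<close> by
  \<open>\<phi>'(t + h)\<close>, which does not change the integral over \<open>t\<close>, and integrating by parts in \<open>h\<close> turns the
  integrand into a multiple of
  \<open>(1 - cos h) (1 - cos d) + sin h (d - sin d)\<close>, where \<open>d = \<Phi> - h\<close>, divided by \<open>(1 - cos h)\<^sup>2\<close>.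
  For \<open>h\<close> and \<open>\<Phi>\<close> between \<open>0\<close> and \<open>2\<pi>\<close> the numerator is nonnegative, and for \<open>0 < h < 2\<pi>\<close> it
  vanishes only if \<open>d = 0\<close>. To avoid singular integrals the computation is made
  with the Poisson kernel at radius \<open>r < 1\<close>, with an error that vanishes as \<open>r\<close> tends to \<open>1\<close>.
\<close>

text \<open>Why the derivative moves from t to t + h: put X = \<phi>(t + h) - \<phi>(t). The change
  (\<phi>'(t + h) - \<phi>'(t)) (1 - cos X) is the t-derivative of the periodic function X - sin X,
  and \<phi>'(t + h) (1 - cos X) is its h-derivative. So a single derivative of \<phi> suffices, as
  fits C^1 boundary data; the price is that the comparison holds only after integration over t.

  The obstacle is the limit of r at 1. The inverse square of the Poisson denominator has integral of
  order 1 / (1 - r)^3, so a remainder with the factor (1 - r)^2 is not small by itself; the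
  Lipschitz bound on f makes it small. In the main term the denominator is at most 4, and its square
  is replaced by 16. What is left is the double integral of a continuous nonnegative function that
  does not involve r. It survives the limit, and equality in the first inequality forces it to
  vanish, so the argument of f on the circle has slope 1 (or -1, if f reverses orientation). The
  Poisson formula then carries the rotation or reflection into the disc.\<close>

unbundle no fps_syntax

subsection \<open>Change of variables in the plane\<close>

text \<open>\<open>g\<close> only relabels coordinates, so it carries boxes to boxes of the same
  content. This moves integrals between \<open>complex\<close>, \<open>real^2\<close> and pairs of
  reals: change of variables is applied on \<open>real^2\<close>, iterated integration on
  pairs.\<close>

lemma has_integral_basis_reindex:
  fixes g :: "'a::euclidean_space \<Rightarrow> 'b::euclidean_space" and f :: "'b \<Rightarrow> 'c::banach"
  assumes lin: "linear g" and bij: "bij_betw g Basis Basis"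
    and S: "bounded S" and f: "(f has_integral i) S"
  shows "((\<lambda>x. f (g x)) has_integral i) (g -` S)"
proof -
  have inner_g: "inner (g x) (g b) = inner x b" if "b \<in> Basis" for x b
  proof -
    have "g x = (\<Sum>c\<in>Basis. inner x c *\<^sub>R g c)"
      by (subst euclidean_representation[of x, symmetric])
        (simp only: linear_sum[OF lin] linear_scale[OF lin])
    also have "inner \<dots> (g b) = (\<Sum>c\<in>Basis. inner x c * (if c = b then 1 else 0))"
      unfolding inner_sum_left inner_scaleR_left
    proof (intro sum.cong refl arg_cong2[where f="(*)"])
      fix c :: 'a assume c: "c \<in> Basis"
      have "g c \<in> Basis" "g b \<in> Basis" "g c = g b \<longleftrightarrow> c = b"
        using bij c that by (auto simp: bij_betw_def inj_on_def)
      then show "inner (g c) (g b) = (if c = b then 1 else 0)"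
        by (auto simp: inner_Basis)
    qed
    also have "\<dots> = inner x b"
      using that by (simp add: if_distrib sum.delta cong: if_cong)
    finally show ?thesis .
  qed
  have gB: "Basis = g ` Basis" using bij by (simp add: bij_betw_def)
  have ball_Basis: "(\<forall>c\<in>Basis. P c) \<longleftrightarrow> (\<forall>b\<in>Basis. P (g b))" for P
    by (subst gB) simp
  define h where "h y = (\<Sum>b\<in>Basis. inner y (g b) *\<^sub>R b)" for y
  have hg: "h (g x) = x" for x
    unfolding h_def by (simp add: inner_g euclidean_representation cong: sum.cong)
  have inner_h: "inner (h y) b = inner y (g b)" if "b \<in> Basis" for y b
    unfolding h_def using that by (simp add: inner_sum_left inner_Basis if_distrib sum.delta' cong: if_cong)
  have gh: "g (h y) = y" for y
  proof (rule euclidean_eqI)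
    fix c :: 'b assume "c \<in> Basis"
    then obtain b where b: "b \<in> Basis" "c = g b" using gB by auto
    then show "inner (g (h y)) c = inner y c" by (simp add: inner_g inner_h)
  qed
  have img: "g ` cbox u v = cbox (g u) (g v)" for u v
  proof -
    have "x \<in> cbox u v \<longleftrightarrow> g x \<in> cbox (g u) (g v)" for x
      by (simp add: mem_box ball_Basis inner_g)
    moreover have "y \<in> g ` X \<longleftrightarrow> h y \<in> X" for y X
      using gh hg by (auto simp: image_iff) (metis gh)
    ultimately show ?thesis using gh by auto
  qed
  have imh: "h ` cbox u v = cbox (h u) (h v)" for u v
  proof -
    have "h ` cbox u v = h ` g ` cbox (h u) (h v)" by (simp only: img gh)
    then show ?thesis by (simp only: image_image hg image_ident)
  qed
  have cont: "measure lborel (g ` cbox u v) = 1 * measure lborel (cbox u v)" for u v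
  proof -
    have "(\<Prod>c\<in>Basis. inner (g v) c - inner (g u) c) = (\<Prod>b\<in>Basis. inner (g v) (g b) - inner (g u) (g b))"
      by (rule prod.reindex_bij_betw[OF bij, symmetric])
    also have "\<dots> = (\<Prod>b\<in>Basis. inner v b - inner u b)"
      by (intro prod.cong refl) (simp only: inner_g)
    finally show ?thesis
      unfolding img content_cbox_cases ball_Basis by (simp only: inner_g mult_1 cong: ball_cong)
  qed
  \<comment> \<open>The substitution rule for integrals works on boxes, so the integrand is extended
    by zero to a box around \<open>S\<close>.\<close>
  obtain a where a: "S \<subseteq> cbox (-a) a"
    using bounded_subset_cbox_symmetric[OF S] by auto
  have "((\<lambda>y. if y \<in> S then f y else 0) has_integral i) (cbox (-a) a)"
    using f a by (simp add: has_integral_restrict)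
  then have "((\<lambda>x. if g x \<in> S then f (g x) else 0) has_integral (1/1) *\<^sub>R i) (h ` cbox (-a) a)"
    using lin by (intro has_integral_twiddle hg gh cont) (auto simp: img imh linear_continuous_at linear_conv_bounded_linear)
  then have "((\<lambda>x. if x \<in> g -` S then f (g x) else 0) has_integral i) (h ` cbox (-a) a)"
    by simp
  moreover have "g -` S \<subseteq> h ` cbox (-a) a"
  proof
    fix x assume "x \<in> g -` S"
    then have "g x \<in> cbox (-a) a" using a by auto
    then have "h (g x) \<in> h ` cbox (-a) a" by (rule imageI)
    then show "x \<in> h ` cbox (-a) a" by (simp only: hg)
  qed
  ultimately show ?thesis
    using has_integral_restrict[of "g -` S" "h ` cbox (-a) a" "\<lambda>x. f (g x)" i] by blast
qed

text \<open>Coordinate isometry with \<open>real^2\<close>, where determinants of matrices and the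
  change of variables theorems apply.\<close>

definition complex_of_vec :: "real^2 \<Rightarrow> complex" where
  "complex_of_vec v = Complex (v$1) (v$2)"

definition vec_of_complex :: "complex \<Rightarrow> real^2" where
  "vec_of_complex z = vector [Re z, Im z]"

lemma vec_of_complex_inverse [simp]: "complex_of_vec (vec_of_complex z) = z"
  by (simp add: complex_of_vec_def vec_of_complex_def)

lemma complex_of_vec_inverse [simp]: "vec_of_complex (complex_of_vec v) = v"
  by (simp add: complex_of_vec_def vec_of_complex_def vec_eq_iff forall_2)

lemma linear_complex_of_vec: "linear complex_of_vec"
  by (rule linearI) (auto simp: complex_of_vec_def complex_eq_iff)

lemma linear_vec_of_complex: "linear vec_of_complex"
  by (rule linearI) (auto simp: vec_of_complex_def vec_eq_iff forall_2)

lemma norm_vec_of_complex [simp]: "norm (vec_of_complex z) = norm z"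
  by (simp add: vec_of_complex_def norm_vec_def L2_set_def UNIV_2 cmod_def)

lemma Basis_real2: "(Basis :: (real^2) set) = {vector [1, 0], vector [0, 1]}"
proof -
  have "axis 1 1 = (vector [1,0] :: real^2)" "axis 2 1 = (vector [0,1] :: real^2)"
    by (auto simp: vec_eq_iff forall_2 axis_def)
  then show ?thesis by (auto simp: Basis_vec_def UNIV_2)
qed

lemma vector2_neq: "(vector [1, 0] :: real^2) \<noteq> vector [0, 1]"
  by (simp add: vec_eq_iff forall_2)

lemma bij_betw_vec_of_complex: "bij_betw vec_of_complex Basis Basis"
  using vector2_neq
  by (auto simp: bij_betw_def inj_on_def Basis_real2 Basis_complex_def vec_of_complex_def)

lemma vector_Pair_Basis: "bij_betw (\<lambda>(x,y). vector [x, y] :: real^2) Basis Basis"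
  using vector2_neq
  by (auto simp: bij_betw_def inj_on_def Basis_real2 Basis_prod_def)

lemma linear_vector_Pair: "linear (\<lambda>(x,y). vector [x, y] :: real^2)"
  by (rule linearI) (auto simp: vec_eq_iff forall_2)


section \<open>Jacobian and Hilbert-Schmidt norm in coordinates\<close>

lemma blinfun_complex_expand:
  fixes L :: "complex \<Rightarrow>\<^sub>L 'a::real_normed_vector"
  shows "L v = Re v *\<^sub>R L 1 + Im v *\<^sub>R L \<i>"
proof -
  have "L v = L (Re v *\<^sub>R 1 + Im v *\<^sub>R \<i>)"
    by (rule arg_cong[where f="blinfun_apply L"]) (simp add: complex_eq_iff)
  then show ?thesis by (simp only: blinfun.add_right blinfun.scaleR_right)
qed

lemma jac_det_eq:
  "jac_det L = Re (blinfun_apply L 1) * Im (blinfun_apply L \<i>) - Im (blinfun_apply L 1) * Re (blinfun_apply L \<i>)"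
  unfolding jac_det_def wirt_z_def wirt_zbar_def cmod_power2
  by (simp add: power2_eq_square) (simp add: field_simps)

lemma hs_norm2_eq: "hs_norm2 L = (norm (blinfun_apply L 1))\<^sup>2 + (norm (blinfun_apply L \<i>))\<^sup>2"
  unfolding hs_norm2_def wirt_z_def wirt_zbar_def cmod_power2
  by (simp add: power2_eq_square) (simp add: field_simps)

lemma det_matrix_conjugate_complex:
  assumes "linear L"
  shows "det (matrix (\<lambda>v. vec_of_complex (L (complex_of_vec v)))) =
     Re (L 1) * Im (L \<i>) - Im (L 1) * Re (L \<i>)"
proof -
  have "axis 1 1 = (vector [1,0] :: real^2)" "axis 2 1 = (vector [0,1] :: real^2)"
    by (auto simp: vec_eq_iff forall_2 axis_def)
  moreover have "complex_of_vec (vector [1,0]) = 1" "complex_of_vec (vector [0,1]) = \<i>"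
    by (auto simp: complex_of_vec_def complex_eq_iff)
  ultimately show ?thesis
    by (simp add: det_2 matrix_def vec_of_complex_def)
qed

lemma bounded_linear_complex_of_vec: "bounded_linear complex_of_vec"
  using linear_complex_of_vec linear_conv_bounded_linear by blast

lemma bounded_linear_vec_of_complex: "bounded_linear vec_of_complex"
  using linear_vec_of_complex linear_conv_bounded_linear by blast

lemma vimage_vec_of_complex: "vec_of_complex -` (complex_of_vec -` S) = S"
  by auto

lemma image_vec_of_complex: "vec_of_complex ` S = complex_of_vec -` S"
  by (auto simp: image_iff) (metis complex_of_vec_inverse)

lemma bounded_vec_of_complex_image:
  assumes "bounded S" shows "bounded (complex_of_vec -` S)"
  using bounded_linear_image[OF assms bounded_linear_vec_of_complex] by (simp add: image_vec_of_complex)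

text \<open>As f is injective, the integral of the absolute Jacobian is the area of the image. The
  computation runs on the closed disc, where the image is given; the circle is negligible.\<close>

lemma jacobian_integral_over_disc:
  assumes img: "f ` cball 0 1 = cball 0 1" and inj: "inj_on f (cball 0 1)"
    and deriv: "\<And>z. z \<in> cball 0 1 \<Longrightarrow> (f has_derivative blinfun_apply (Df z)) (at z within cball 0 1)"
  shows "((\<lambda>z. \<bar>jac_det (Df z)\<bar>) has_integral pi) (ball 0 1)"
proof -
  define B where "B = complex_of_vec -` (cball 0 1)"
  have B_alt: "B = cball 0 1"
    unfolding B_def by (auto simp: norm_vec_of_complex[symmetric] simp del: norm_vec_of_complex)
  define F where "F v = vec_of_complex (f (complex_of_vec v))" for v
  have F_image: "F ` B = B"
  proof -
    have "F ` B = vec_of_complex ` f ` complex_of_vec ` B" by (simp add: F_def image_image)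
    also have "complex_of_vec ` B = cball 0 1"
      unfolding B_def image_vec_of_complex[symmetric] by (simp add: image_image)
    finally show ?thesis by (simp add: img image_vec_of_complex B_def)
  qed
  have F_inj: "inj_on F B"
    using inj unfolding F_def B_def inj_on_def by (metis complex_of_vec_inverse vec_of_complex_inverse vimageD)
  have F_deriv: "(F has_derivative (\<lambda>h. vec_of_complex (Df (complex_of_vec v) (complex_of_vec h)))) (at v within B)"
    if "v \<in> B" for v
  proof -
    have *: "(f has_derivative blinfun_apply (Df (complex_of_vec v))) (at (complex_of_vec v) within complex_of_vec ` B)"
      using that by (intro has_derivative_subset[OF deriv]) (auto simp: B_def)
    show ?thesis unfolding F_def
      using bounded_linear.has_derivative[OF bounded_linear_vec_of_complex
          diff_chain_within[OF bounded_linear_imp_has_derivative[OF bounded_linear_complex_of_vec] *]]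
      by (simp add: o_def)
  qed
  have "B \<in> sets lebesgue" by (simp add: B_alt)
  moreover have "F ` B \<in> lmeasurable \<and> measure lebesgue (F ` B) = pi"
    unfolding F_image unfolding B_alt
    using circle_area[of 1 0] by (simp add: content_cball_conv_ball)
  ultimately have "((\<lambda>v. \<bar>det (matrix (\<lambda>h. vec_of_complex (Df (complex_of_vec v) (complex_of_vec h))))\<bar>) has_integral pi) B"
    using has_measure_differentiable_image[OF _ F_deriv F_inj, of pi] by blast
  then have "((\<lambda>v. \<bar>jac_det (Df (complex_of_vec v))\<bar>) has_integral pi) B"
    by (subst (asm) det_matrix_conjugate_complex) (auto simp: jac_det_eq blinfun.bounded_linear_right bounded_linear.linear)
  then have "((\<lambda>z. \<bar>jac_det (Df z)\<bar>) has_integral pi) (cball 0 1)"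
    using has_integral_basis_reindex[OF linear_vec_of_complex bij_betw_vec_of_complex, of B
        "\<lambda>v. \<bar>jac_det (Df (complex_of_vec v))\<bar>" pi]
    by (simp add: B_def vimage_vec_of_complex bounded_vec_of_complex_image)
  then show ?thesis
    by (subst (asm) has_integral_spike_set_eq[where T="ball 0 1"])
      (auto intro: negligible_subset[OF negligible_sphere[of 0 1]])
qed

lemma absolutely_integrable_on_continuous_compact:
  fixes g :: "'a::euclidean_space \<Rightarrow> real"
  assumes "compact S" "continuous_on S g"
  shows "g absolutely_integrable_on S"
proof -
  have "integrable lborel (\<lambda>x. indicator S x *\<^sub>R g x)"
    by (rule borel_integrable_compact[OF assms])
  then show ?thesis
    unfolding set_integrable_def
    using integrable_completion borel_measurable_integrable by blast
qed

text \<open>Positive radius and half-open angle make the polar map injective; its image misses only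
  the origin of the closed disc, and its Jacobian is the radius.\<close>

lemma polar_coordinates_has_integral:
  fixes g :: "complex \<Rightarrow> real"
  assumes gi: "g absolutely_integrable_on cball 0 1" "integral (cball 0 1) g = I"
  shows "((\<lambda>v. v$1 * g (of_real (v$1) * cis (v$2))) has_integral I)
    {v :: real^2. 0 < v$1 \<and> v$1 \<le> 1 \<and> 0 \<le> v$2 \<and> v$2 < 2*pi}"
proof -
  define S :: "(real^2) set" where "S = {v. 0 < v$1 \<and> v$1 \<le> 1 \<and> 0 \<le> v$2 \<and> v$2 < 2*pi}"
  define P :: "real^2 \<Rightarrow> real^2" where "P v = vec_of_complex (of_real (v$1) * cis (v$2))" for v
  define P' :: "real^2 \<Rightarrow> real^2 \<Rightarrow> real^2" where
    "P' v h = vector [cos (v$2) * h$1 - v$1 * sin (v$2) * h$2, sin (v$2) * h$1 + v$1 * cos (v$2) * h$2]" for v h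
  have P_alt: "P v = vector [v$1 * cos (v$2), v$1 * sin (v$2)]" for v
    by (simp add: P_def vec_of_complex_def)
  have S_meas: "S \<in> sets lebesgue"
  proof -
    have "S = cbox (vector [0, 0]) (vector [1, 2*pi]) - {v. v$1 = 0} - {v. v$2 = 2*pi}"
      by (auto simp: S_def mem_box_cart forall_2)
    moreover have "closed {v::real^2. v$1 = 0}" "closed {v::real^2. v$2 = 2*pi}"
      by (auto intro!: closed_Collect_eq continuous_intros)
    ultimately show ?thesis by auto
  qed
  have P_deriv: "(P has_derivative P' v) (at v within S)" for v
    unfolding has_derivative_componentwise_within[of P] Basis_real2 P_alt P'_def
    by (auto intro!: derivative_eq_intros bounded_linear.has_derivative[OF bounded_linear_vec_nth]
        simp: inner_vec_def UNIV_2 algebra_simps)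
  have P_inj: "inj_on P S"
  proof (rule inj_onI)
    fix v w assume v: "v \<in> S" "w \<in> S" and eq: "P v = P w"
    have *: "norm (complex_of_vec (P v)) = v$1" "Arg2pi (complex_of_vec (P v)) = v$2" if "v \<in> S" for v
      using that Arg2pi_unique[of "v$1" "v$2"] by (auto simp: P_def S_def norm_mult cis_conv_exp)
    show "v = w" using *[OF v(1)] *[OF v(2)] eq by (simp add: vec_eq_iff forall_2)
  qed
  have P_img: "P ` S = complex_of_vec -` (cball 0 1 - {0})"
  proof -
    have "complex_of_vec ` P ` S = cball 0 1 - {0}"
    proof (intro equalityI subsetI)
      fix z assume z: "z \<in> cball (0::complex) 1 - {0}"
      have "z = complex_of_vec (P (vector [norm z, Arg2pi z]))"
        using Arg2pi_eq[of z] by (simp add: P_def cis_conv_exp)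
      moreover have "vector [norm z, Arg2pi z] \<in> S"
        using z Arg2pi[of z] by (simp add: S_def)
      ultimately show "z \<in> complex_of_vec ` P ` S" by blast
    qed (auto simp: P_def S_def norm_mult)
    then have "vec_of_complex ` complex_of_vec ` P ` S = vec_of_complex ` (cball 0 1 - {0})" by simp
    then show ?thesis by (simp only: image_vec_of_complex image_image complex_of_vec_inverse image_ident)
  qed
  have det: "det (matrix (P' v)) = v$1" for v
  proof -
    have "axis 1 1 = (vector [1,0] :: real^2)" "axis 2 1 = (vector [0,1] :: real^2)"
      by (auto simp: vec_eq_iff forall_2 axis_def)
    then show ?thesis
      by (simp add: det_2 matrix_def P'_def algebra_simps) (metis distrib_left mult_1_right sin_cos_squared_add3)
  qed
  have transfer: "((\<lambda>v. h (complex_of_vec v)) has_integral integral (cball 0 1) h)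
       (complex_of_vec -` (cball 0 1 - {0}))" if "h absolutely_integrable_on cball 0 1" for h :: "complex \<Rightarrow> real"
  proof -
    have "(h has_integral integral (cball 0 1) h) (cball 0 1)"
      using that by (simp add: set_lebesgue_integral_eq_integral(1) integrable_integral)
    then have "(h has_integral integral (cball 0 1) h) (cball 0 1 - {0})"
      by (subst (asm) has_integral_spike_set_eq[where T="cball 0 1 - {0}"])
        (auto intro: negligible_subset[of "{0}"])
    moreover have "bij_betw complex_of_vec Basis Basis"
      using vector2_neq
      by (auto simp: bij_betw_def inj_on_def Basis_real2 Basis_complex_def complex_of_vec_def complex_eq_iff)
    ultimately show ?thesis
      by (intro has_integral_basis_reindex linear_complex_of_vec) (auto intro: bounded_subset[of "cball 0 1"])
  qed
  \<comment> \<open>The change of variables theorem is stated for vector-valued integrands, hence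
    \<open>real^1\<close>.\<close>
  define f :: "real^2 \<Rightarrow> real^1" where "f v = vec (g (complex_of_vec v))" for v
  have "f absolutely_integrable_on (P ` S) \<and> integral (P ` S) f = vec I"
  proof
    have "(\<lambda>v. g (complex_of_vec v)) integrable_on P ` S"
      unfolding P_img using transfer[OF gi(1)] by blast
    moreover have "(\<lambda>z. \<bar>g z\<bar>) absolutely_integrable_on cball 0 1"
      using absolutely_integrable_norm[OF gi(1)] by (simp add: o_def)
    then have "(\<lambda>v. norm (g (complex_of_vec v))) integrable_on P ` S"
      unfolding P_img using transfer by auto
    ultimately show "f absolutely_integrable_on (P ` S)"
      by (simp add: absolutely_integrable_on_1_iff f_def absolutely_integrable_on_def)
    show "integral (P ` S) f = vec I"
      using transfer[OF gi(1)] by (simp add: f_def integral_on_1_eq P_img gi(2) integral_unique)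
  qed
  then have "(\<lambda>v. \<bar>det (matrix (P' v))\<bar> *\<^sub>R f (P v)) absolutely_integrable_on S \<and>
      integral S (\<lambda>v. \<bar>det (matrix (P' v))\<bar> *\<^sub>R f (P v)) = vec I"
    using has_absolute_integral_change_of_variables[OF S_meas P_deriv P_inj] by blast
  then have "((\<lambda>v. \<bar>v$1\<bar> * g (of_real (v$1) * cis (v$2))) has_integral I) S"
    by (simp add: det absolutely_integrable_on_1_iff integral_on_1_eq f_def P_def has_integral_iff vec_eq_iff
      set_lebesgue_integral_eq_integral(1))
  then show ?thesis unfolding S_def
    by (rule has_integral_eq[rotated]) auto
qed

lemma integral_ball_polar:
  fixes g :: "complex \<Rightarrow> real"
  assumes g: "continuous_on (cball 0 1) g"
  shows "integral (ball 0 1) g = integral {0..1} (\<lambda>r. integral {0..2*pi} (\<lambda>t. r * g (of_real r * cis t)))"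
proof -
  define S :: "(real^2) set" where "S = {v. 0 < v$1 \<and> v$1 \<le> 1 \<and> 0 \<le> v$2 \<and> v$2 < 2*pi}"
  define I where "I = integral (cball 0 1) g"
  have "((\<lambda>v. v$1 * g (of_real (v$1) * cis (v$2))) has_integral I) S"
    unfolding S_def by (rule polar_coordinates_has_integral)
      (auto simp: I_def intro: absolutely_integrable_on_continuous_compact g)
  moreover have "bounded S"
    by (rule bounded_subset[OF bounded_cbox[of "vector [0,0]" "vector [1, 2*pi]"]])
       (auto simp: S_def mem_box_cart forall_2)
  ultimately have "((\<lambda>p. fst p * g (of_real (fst p) * cis (snd p))) has_integral I) {p. (\<lambda>(x,y). vector [x,y]) p \<in> S}"
    using has_integral_basis_reindex[OF linear_vector_Pair vector_Pair_Basis, of S]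
    by (fastforce simp: vimage_def case_prod_beta)
  then have "((\<lambda>p. fst p * g (of_real (fst p) * cis (snd p))) has_integral I) (cbox (0,0) (1,2*pi))"
  proof (subst (asm) has_integral_spike_set_eq[where T="cbox (0,0) (1,2*pi)"])
    \<comment> \<open>The closed rectangle exceeds \<open>S\<close> only by the edges of radius 0
      and of angle \<open>2*pi\<close>.\<close>
    have "negligible (cbox (0::real,0::real) (0,2*pi) \<union> cbox (0,2*pi) (1,2*pi))" (is "negligible ?N")
      by (intro negligible_Un) (simp_all add: negligible_iff_null_sets null_sets_def emeasure_lborel_cbox_eq Basis_prod_def)
    then show "negligible {p \<in> {p. (\<lambda>(x,y). vector [x,y]) p \<in> S} - cbox (0, 0) (1, 2 * pi).
         fst p * g (complex_of_real (fst p) * cis (snd p)) \<noteq> 0}"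
      "negligible {p \<in> cbox (0, 0) (1, 2 * pi) - {p. (\<lambda>(x,y). vector [x,y]) p \<in> S}.
         fst p * g (complex_of_real (fst p) * cis (snd p)) \<noteq> 0}"
      by (rule negligible_subset, fastforce simp: S_def cbox_Pair_eq)+
  qed
  then have "I = integral (cbox (0,0) (1,2*pi)) (\<lambda>p. fst p * g (of_real (fst p) * cis (snd p)))"
    by (simp add: integral_unique)
  also have "\<dots> = integral (cbox 0 1) (\<lambda>r. integral (cbox 0 (2*pi)) (\<lambda>t. fst (r,t) * g (of_real (fst (r,t)) * cis (snd (r,t)))))"
    by (intro integral_prod_continuous continuous_intros continuous_on_compose2[OF g])
      (auto simp: norm_mult cbox_Pair_eq)
  finally have "I = \<dots>" .
  moreover have "integral (ball 0 1) g = I" unfolding I_def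
    by (rule integral_spike_set) (auto intro: negligible_subset[OF negligible_sphere[of 0 1]])
  ultimately show ?thesis by simp
qed

subsection \<open>Harmonic functions and the Poisson formula\<close>

text \<open>The Cauchy-Riemann equations for f_z and for the conjugate of f_zbar need equal mixed
  derivatives, which \<open>harmonic_on\<close> does not state. They follow from the Leibniz rule on
  a parallelogram with sides parallel to \<open>u\<close> and \<open>v\<close>.\<close>

lemma second_derivative_symmetric:
  fixes f :: "'a::real_normed_vector \<Rightarrow> 'b::banach"
  assumes S: "open S" "z \<in> S"
    and f: "\<And>x. x \<in> S \<Longrightarrow> (f has_derivative blinfun_apply (D1 x)) (at x)"
    and D1: "\<And>x. x \<in> S \<Longrightarrow> (D1 has_derivative blinfun_apply (D2 x)) (at x)"
    and D2: "continuous_on S D2"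
  shows "D2 z u v = D2 z v u"
proof -
  obtain d where d: "d > 0" "ball z d \<subseteq> S" using S openE by blast
  define N where "N = norm u + norm v + 1"
  have N: "N > 0" unfolding N_def by (meson add_nonneg_pos add_nonneg_nonneg norm_ge_zero zero_less_one)
  \<comment> \<open>Keeps \<open>p x y\<close> within \<open>d / 2\<close> of \<open>z\<close>
    whenever x and y are at most \<open>e\<close> in absolute value; the summand 1 in
    \<open>N\<close> covers u = v = 0.\<close>
  define e where "e = d / N / 2"
  have e: "e > 0" using d(1) N by (simp add: e_def)
  define p where "p x y = z + x *\<^sub>R u + y *\<^sub>R v" for x y :: real
  have p: "p x y \<in> S" if "x \<in> {-e..e}" "y \<in> {-e..e}" for x y
  proof -
    have "norm (x *\<^sub>R u + y *\<^sub>R v) \<le> \<bar>x\<bar> * norm u + \<bar>y\<bar> * norm v"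
      by (rule order_trans[OF norm_triangle_ineq]) simp
    also have "\<dots> \<le> e * norm u + e * norm v"
      using that by (intro add_mono mult_right_mono) auto
    also have "\<dots> \<le> e * N" using e by (simp add: N_def algebra_simps)
    also have "\<dots> = d / 2" using N by (simp add: e_def)
    also have "\<dots> < d" using d(1) by simp
    finally have "norm (p x y - z) < d" by (simp add: p_def add.assoc)
    then have "p x y \<in> ball z d" by (simp add: dist_norm norm_minus_commute)
    then show ?thesis using d(2) by blast
  qed
  have D1_cont: "continuous_on S D1"
    by (rule has_derivative_continuous_on[where f'="\<lambda>x. blinfun_apply (D2 x)"])
      (rule has_derivative_at_withinI[OF D1])
  have dx: "((\<lambda>x. f (p x y)) has_vector_derivative D1 (p x y) u) (at x within X)"
    if "x \<in> {-e..e}" "y \<in> {-e..e}" for x y X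
  proof -
    have "((\<lambda>x. p x y) has_derivative (\<lambda>h. h *\<^sub>R u)) (at x within X)"
      unfolding p_def by (auto intro!: derivative_eq_intros)
    from has_derivative_compose[OF this f[OF p[OF that]]] show ?thesis
      by (simp add: has_vector_derivative_def blinfun.scaleR_right)
  qed
  have dy: "((\<lambda>y. f (p x y)) has_vector_derivative D1 (p x y) v) (at y within X)"
    if "x \<in> {-e..e}" "y \<in> {-e..e}" for x y X
  proof -
    have "((\<lambda>y. p x y) has_derivative (\<lambda>h. h *\<^sub>R v)) (at y within X)"
      unfolding p_def by (auto intro!: derivative_eq_intros)
    from has_derivative_compose[OF this f[OF p[OF that]]] show ?thesis
      by (simp add: has_vector_derivative_def blinfun.scaleR_right)
  qed
  have dxv: "((\<lambda>x. D1 (p x y) w) has_vector_derivative D2 (p x y) u w) (at x within X)"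
    if "x \<in> {-e..e}" "y \<in> {-e..e}" for x y X w
  proof -
    have "((\<lambda>x. p x y) has_derivative (\<lambda>h. h *\<^sub>R u)) (at x within X)"
      unfolding p_def by (auto intro!: derivative_eq_intros)
    from bounded_linear.has_derivative[OF blinfun.bounded_linear_left has_derivative_compose[OF this D1[OF p[OF that]]]]
    show ?thesis by (simp add: has_vector_derivative_def blinfun.scaleR_right blinfun.scaleR_left)
  qed
  have dyv: "((\<lambda>y. D1 (p x y) w) has_vector_derivative D2 (p x y) v w) (at y within X)"
    if "x \<in> {-e..e}" "y \<in> {-e..e}" for x y X w
  proof -
    have "((\<lambda>y. p x y) has_derivative (\<lambda>h. h *\<^sub>R v)) (at y within X)"
      unfolding p_def by (auto intro!: derivative_eq_intros)
    from bounded_linear.has_derivative[OF blinfun.bounded_linear_left has_derivative_compose[OF this D1[OF p[OF that]]]]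
    show ?thesis by (simp add: has_vector_derivative_def blinfun.scaleR_right blinfun.scaleR_left)
  qed
  have cont2: "continuous_on ({-e..e} \<times> {-e..e}) (\<lambda>q. D2 (p (snd q) (fst q)) v u)"
    by (intro continuous_intros continuous_on_compose2[OF D2])
       (auto simp: p_def[abs_def] intro!: continuous_intros p[unfolded p_def])
  \<comment> \<open>Differentiate \<open>f(p x y) - f(p (-e) y) = \<integral> D1 (p s y) u ds\<close> in \<open>y\<close>, and below in \<open>x\<close>.\<close>
  have key: "D1 (p x 0) v - D1 (p (-e) 0) v = integral {-e..x} (\<lambda>s. D2 (p s 0) v u)"
    if x: "x \<in> {-e..e}" for x
  proof -
    have "((\<lambda>y. integral (cbox (-e) x) (\<lambda>s. D1 (p s y) u)) has_vector_derivative
        integral (cbox (-e) x) (\<lambda>s. D2 (p s 0) v u)) (at 0 within {-e..e})"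
    proof (rule leibniz_rule_vector_derivative)
      show "((\<lambda>y. D1 (p s y) u) has_vector_derivative D2 (p s y) v u) (at y within {-e..e})"
        if "y \<in> {-e..e}" "s \<in> cbox (-e) x" for y s using that x by (intro dyv) auto
      show "(\<lambda>s. D1 (p s y) u) integrable_on cbox (-e) x" if "y \<in> {-e..e}" for y
        using x that
        by (intro integrable_continuous continuous_intros continuous_on_compose2[OF D1_cont])
           (auto simp: p_def[abs_def] intro!: continuous_intros p[unfolded p_def])
      show "continuous_on ({-e..e} \<times> cbox (-e) x) (\<lambda>(y, s). D2 (p s y) v u)"
        using continuous_on_subset[OF cont2, of "{-e..e} \<times> cbox (-e) x"] x
        by (simp add: case_prod_beta subset_iff)
    qed (use e in auto)
    moreover have "((\<lambda>y. integral (cbox (-e) x) (\<lambda>s. D1 (p s y) u)) has_vector_derivative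
        D1 (p x 0) v - D1 (p (-e) 0) v) (at 0 within {-e..e})"
    proof (rule has_vector_derivative_transform)
      show "0 \<in> {-e..e}" using e by simp
      show "integral (cbox (-e) x) (\<lambda>s. D1 (p s y) u) = f (p x y) - f (p (-e) y)" if "y \<in> {-e..e}" for y
        using x that by (intro integral_unique, unfold cbox_interval, intro fundamental_theorem_of_calculus dx) auto
      show "((\<lambda>y. f (p x y) - f (p (-e) y)) has_vector_derivative D1 (p x 0) v - D1 (p (-e) 0) v) (at 0 within {-e..e})"
        using x e by (intro has_vector_derivative_diff dy) auto
    qed
    ultimately show ?thesis using e
      by (intro vector_derivative_unique_within[where x=0 and S="{-e..e}"])
        (auto simp: at_within_interior[of 0 "{-e..e}"] simp del: at_within_Icc_at)
  qed
  have "((\<lambda>x. integral {-e..x} (\<lambda>s. D2 (p s 0) v u)) has_vector_derivative D2 (p 0 0) v u) (at 0 within {-e..e})"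
  proof (rule integral_has_vector_derivative)
    have "continuous_on {-e..e} (\<lambda>s. (0::real, s))" by (intro continuous_intros)
    moreover have "Pair (0::real) ` {-e..e} \<subseteq> {-e..e} \<times> {-e..e}" using e by auto
    ultimately show "continuous_on {-e..e} (\<lambda>s. D2 (p s 0) v u)"
      using continuous_on_compose2[OF cont2] by fastforce
  qed (use e in auto)
  moreover have "((\<lambda>x. integral {-e..x} (\<lambda>s. D2 (p s 0) v u)) has_vector_derivative D2 (p 0 0) u v) (at 0 within {-e..e})"
  proof (rule has_vector_derivative_transform)
    show "0 \<in> {-e..e}" using e by simp
    show "integral {-e..x} (\<lambda>s. D2 (p s 0) v u) = D1 (p x 0) v - D1 (p (-e) 0) v" if "x \<in> {-e..e}" for x
      using key[OF that] by simp
    show "((\<lambda>x. D1 (p x 0) v - D1 (p (-e) 0) v) has_vector_derivative D2 (p 0 0) u v) (at 0 within {-e..e})"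
      using has_vector_derivative_diff[OF dxv has_vector_derivative_const] e by fastforce
  qed
  ultimately have "D2 (p 0 0) u v = D2 (p 0 0) v u" using e
    by (intro vector_derivative_unique_within[where x=0 and S="{-e..e}"])
      (auto simp: at_within_interior[of 0 "{-e..e}"] simp del: at_within_Icc_at)
  then show ?thesis by (simp add: p_def)
qed

text \<open>The second hypothesis is the Cauchy-Riemann condition: it turns a real-linear map into a
  complex-linear one.\<close>

lemma bounded_linear_complex_eq_mult:
  fixes L :: "complex \<Rightarrow> complex"
  assumes "bounded_linear L" "L \<i> = \<i> * L 1"
  shows "L v = L 1 * v"
proof -
  have lin: "linear L" using assms(1) by (rule bounded_linear.linear)
  have "L v = L (Re v *\<^sub>R 1 + Im v *\<^sub>R \<i>)" by (rule arg_cong[where f=L]) (simp add: complex_eq_iff)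
  also have "\<dots> = Re v *\<^sub>R L 1 + Im v *\<^sub>R L \<i>" by (simp only: linear_add[OF lin] linear_scale[OF lin])
  also have "\<dots> = L 1 * v" unfolding assms(2) by (simp add: complex_eq_iff algebra_simps)
  finally show ?thesis .
qed

text \<open>The Laplacian is four times the mixed Wirtinger derivative, so f_z and the conjugate of
  f_zbar are holomorphic. The ball is convex, so both have primitives, \<open>H\<close> and
  \<open>G\<close>. Subtracting \<open>H\<close> and the conjugate of \<open>G\<close> from f leaves
  a function with zero derivative, whose constant value is absorbed into \<open>H\<close>.\<close>

lemma harmonic_on_holomorphic_decomposition:
  assumes harm: "harmonic_on f (ball c R)"
  obtains H G where "H holomorphic_on ball c R" "G holomorphic_on ball c R"
    "\<And>z. z \<in> ball c R \<Longrightarrow> f z = H z + cnj (G z)"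
proof -
  let ?B = "ball c R"
  from harm obtain D1 D2 where D1: "\<And>z. z \<in> ?B \<Longrightarrow> (f has_derivative blinfun_apply (D1 z)) (at z)"
    and D2: "\<And>z. z \<in> ?B \<Longrightarrow> (D1 has_derivative blinfun_apply (D2 z)) (at z)"
    and cont: "continuous_on ?B D2"
    and lap: "\<And>z. z \<in> ?B \<Longrightarrow> D2 z 1 1 + D2 z \<i> \<i> = 0"
    unfolding harmonic_on_def by blast
  have sym: "D2 z 1 \<i> = D2 z \<i> 1" if "z \<in> ?B" for z
    by (rule second_derivative_symmetric[OF _ that D1 D2 cont]) auto
  define h where "h z = wirt_z (D1 z)" for z
  define g where "g z = cnj (wirt_zbar (D1 z))" for z
  have lap': "D2 z \<i> \<i> = - D2 z 1 1" if "z \<in> ?B" for z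
    using lap[OF that] by (simp add: eq_neg_iff_add_eq_0 add.commute)
  have apply_deriv: "((\<lambda>z. D1 z w) has_derivative (\<lambda>v. D2 z v w)) (at z)" if "z \<in> ?B" for z w
    by (rule bounded_linear.has_derivative[OF blinfun.bounded_linear_left D2[OF that]])
  have h: "(h has_field_derivative wirt_z (D2 z 1)) (at z)" if z: "z \<in> ?B" for z
  proof -
    let ?L = "\<lambda>v. wirt_z (D2 z v)"
    have d: "(h has_derivative ?L) (at z)"
      unfolding h_def wirt_z_def
      by (intro bounded_linear.has_derivative[OF bounded_linear_divide] has_derivative_diff
          has_derivative_mult_right apply_deriv z)
    then have bl: "bounded_linear ?L" by (rule has_derivative_bounded_linear)
    \<comment> \<open>Symmetry together with the Laplace equation is exactly
      \<open>?L \<i> = \<i> * ?L 1\<close>.\<close>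
    have "?L v = ?L 1 * v" for v
      using bl
      by (rule bounded_linear_complex_eq_mult) (simp add: wirt_z_def sym[OF z] lap'[OF z] field_simps)
    then show ?thesis
      unfolding has_field_derivative_def by (intro has_derivative_eq_rhs[OF d] ext)
  qed
  have g: "(g has_field_derivative cnj (wirt_zbar (D2 z 1))) (at z)" if z: "z \<in> ?B" for z
  proof -
    let ?L = "\<lambda>v. cnj (wirt_zbar (D2 z v))"
    have d: "(g has_derivative ?L) (at z)"
      unfolding g_def wirt_zbar_def
      by (intro bounded_linear.has_derivative[OF bounded_linear_cnj]
          bounded_linear.has_derivative[OF bounded_linear_divide] has_derivative_add
          has_derivative_mult_right apply_deriv z)
    then have bl: "bounded_linear ?L" by (rule has_derivative_bounded_linear)
    have "?L v = ?L 1 * v" for v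
      using bl
      by (rule bounded_linear_complex_eq_mult) (simp add: wirt_zbar_def sym[OF z] lap'[OF z] field_simps)
    then show ?thesis
      unfolding has_field_derivative_def by (intro has_derivative_eq_rhs[OF d] ext)
  qed
  have "h holomorphic_on ?B" "g holomorphic_on ?B"
    using h g by (meson has_field_derivative_at_within holomorphic_onI field_differentiable_def)+
  then obtain H G where H: "\<And>x. x \<in> ?B \<Longrightarrow> (H has_field_derivative h x) (at x within ?B)"
    and G: "\<And>x. x \<in> ?B \<Longrightarrow> (G has_field_derivative g x) (at x within ?B)"
    by (metis convex_ball open_ball holomorphic_convex_primitive')
  have "((\<lambda>z. f z - H z - cnj (G z)) has_derivative (\<lambda>v. 0)) (at z within ?B)" if z: "z \<in> ?B" for z
  proof -
    have "((\<lambda>z. f z - H z - cnj (G z)) has_derivative (\<lambda>v. D1 z v - h z * v - cnj (g z * v))) (at z within ?B)"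
      using H[OF z] G[OF z] D1[OF z] unfolding has_field_derivative_def
      by (intro derivative_intros bounded_linear.has_derivative[OF bounded_linear_cnj])
         (auto intro: has_derivative_at_withinI)
    moreover have "D1 z v - h z * v - cnj (g z * v) = 0" for v
      unfolding blinfun_complex_expand[of "D1 z" v]
      by (simp add: h_def g_def wirt_z_def wirt_zbar_def complex_eq_iff field_simps)
    ultimately show ?thesis by simp
  qed
  from has_derivative_zero_constant[OF convex_ball this]
  obtain k where k: "\<And>z. z \<in> ?B \<Longrightarrow> f z - H z - cnj (G z) = k"
    by blast
  have hol: "H holomorphic_on ?B" "G holomorphic_on ?B"
    unfolding holomorphic_on_def field_differentiable_def using H G by blast+
  show thesis
  proof
    show "(\<lambda>z. H z + k) holomorphic_on ?B" "G holomorphic_on ?B"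
      by (intro holomorphic_intros hol)+
    show "f z = H z + k + cnj (G z)" if "z \<in> ?B" for z
      using k[OF that] by (simp add: algebra_simps)
  qed
qed

section \<open>Limits at an endpoint and the Poisson kernel\<close>

lemma continuous_on_le_at_right_end:
  fixes F G :: "real \<Rightarrow> real"
  assumes "continuous_on {a..b} F" "continuous_on {a..b} G" "a < b" "\<And>x. a \<le> x \<Longrightarrow> x < b \<Longrightarrow> F x \<le> G x"
  shows "F b \<le> G b"
proof (rule tendsto_le[OF trivial_limit_at_left_real])
  show "(G \<longlongrightarrow> G b) (at_left b)" "(F \<longlongrightarrow> F b) (at_left b)"
    using assms by (auto intro: continuous_on_Icc_at_leftD)
  show "\<forall>\<^sub>F x in at_left b. F x \<le> G x"
    using eventually_at_left_real[OF assms(3)] by eventually_elim (use assms in auto)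
qed

lemma continuous_on_eq_at_right_end:
  fixes F G :: "real \<Rightarrow> 'a::t2_space"
  assumes "continuous_on {a..b} F" "continuous_on {a..b} G" "a < b" "\<And>x. a \<le> x \<Longrightarrow> x < b \<Longrightarrow> F x = G x"
  shows "F b = G b"
proof (rule tendsto_unique[OF trivial_limit_at_left_real])
  show "(F \<longlongrightarrow> F b) (at_left b)"
    using assms by (auto intro: continuous_on_Icc_at_leftD)
  have "(G \<longlongrightarrow> G b) (at_left b)"
    using assms by (auto intro: continuous_on_Icc_at_leftD)
  moreover have "\<forall>\<^sub>F x in at_left b. G x = F x"
    using eventually_at_left_real[OF assms(3)] by eventually_elim (use assms in auto)
  ultimately show "(F \<longlongrightarrow> G b) (at_left b)" using tendsto_cong by blast
qed

lemma continuous_on_slice: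
  assumes "continuous_on (A \<times> B) (\<lambda>x. p (fst x) (snd x))" and r: "r \<in> A"
  shows "continuous_on B (p r)"
proof -
  have "continuous_on B (\<lambda>t. p (fst (r, t)) (snd (r, t)))"
    by (rule continuous_on_compose2[OF assms(1)]) (use r in \<open>auto intro!: continuous_intros\<close>)
  then show ?thesis by simp
qed

text \<open>This is the squared modulus of 1 - r cis h. It is named apart from the Poisson kernel
  because it also occurs squared and under the numerator 1 + r.\<close>

definition poisson_denom :: "real \<Rightarrow> real \<Rightarrow> real" where
  "poisson_denom r h = 1 - 2 * r * cos h + r\<^sup>2"

lemma poisson_denom_ge: "0 \<le> r \<Longrightarrow> (1 - r)\<^sup>2 \<le> poisson_denom r h"
  using mult_left_le[of "cos h" r] by (simp add: poisson_denom_def power2_eq_square algebra_simps)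

lemma poisson_denom_pos: "0 \<le> r \<Longrightarrow> r < 1 \<Longrightarrow> 0 < poisson_denom r h"
  by (rule less_le_trans[OF _ poisson_denom_ge]) auto

lemma continuous_on_poisson_denom [continuous_intros]:
  fixes A :: "'a::t2_space set"
  shows "continuous_on A k \<Longrightarrow> continuous_on A l \<Longrightarrow> continuous_on A (\<lambda>x. poisson_denom (k x) (l x))"
  unfolding poisson_denom_def by (intro continuous_intros)

lemma poisson_denom_factor:
  "of_real (poisson_denom r h) = (1 - of_real r * cis h) * (1 - of_real r * cis (-h))"
  by (simp add: poisson_denom_def complex_eq_iff power2_eq_square algebra_simps)
    (metis distrib_left mult_1_right sin_cos_squared_add3 add.commute)

text \<open>Evaluation at real points 0 \<le> r < 1 suffices: a rotation of the argument of
  \<open>K\<close> reaches every other point of the disc.\<close>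

lemma poisson_integral_holomorphic:
  assumes K: "continuous_on (cball 0 1) K" "K holomorphic_on ball 0 1" and r: "0 \<le> r" "r < 1"
  shows "((\<lambda>h. ((1 - r\<^sup>2) / poisson_denom r h) *\<^sub>R K (cis h)) has_integral (2*pi) *\<^sub>R K (of_real r)) {0..2*pi}"
proof -
  have nz: "1 - of_real r * z \<noteq> 0" if "norm z \<le> 1" for z :: complex
  proof
    assume "1 - of_real r * z = 0"
    then have "norm (of_real r * z) = norm (1::complex)" by simp
    moreover have "norm (of_real r * z) \<le> r * 1"
      unfolding norm_mult using r that by (simp add: mult_left_le)
    ultimately show False using r by simp
  qed
  have "((\<lambda>u. K u / (u - of_real r)) has_contour_integral (2 * of_real pi * \<i> * K (of_real r))) (circlepath 0 1)"
    by (rule Cauchy_integral_circlepath) (use K r in auto)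
  then have 1: "((\<lambda>h. K (cis h) / (cis h - of_real r) * \<i> * cis h) has_integral 2 * of_real pi * \<i> * K (of_real r)) {0..2*pi}"
    unfolding circlepath_def by (subst (asm) has_contour_integral_part_circlepath_iff) auto
  \<comment> \<open>The Poisson kernel is the Cauchy kernel at \<open>r\<close> plus a term that is holomorphic in the disc.\<close>
  define K2 where "K2 u = K u * of_real r * u / (1 - of_real r * u)" for u
  \<comment> \<open>\<open>K2\<close> vanishes at 0, so by Cauchy's formula the added term does not
    change the value.\<close>
  have "((\<lambda>u. K2 u / (u - 0)) has_contour_integral (2 * of_real pi * \<i> * K2 0)) (circlepath 0 1)"
  proof (rule Cauchy_integral_circlepath)
    show "continuous_on (cball 0 1) K2" unfolding K2_def
      by (intro continuous_intros K) (use nz in auto)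
    show "K2 holomorphic_on ball 0 1" unfolding K2_def
      by (intro holomorphic_intros K) (use nz in auto)
  qed auto
  then have 2: "((\<lambda>h. K2 (cis h) / cis h * \<i> * cis h) has_integral 0) {0..2*pi}"
    unfolding circlepath_def by (subst (asm) has_contour_integral_part_circlepath_iff) (auto simp: K2_def)
  have eq: "(K (cis h) / (cis h - of_real r) * \<i> * cis h + K2 (cis h) / cis h * \<i> * cis h) * (-\<i>) =
      ((1 - r\<^sup>2) / poisson_denom r h) *\<^sub>R K (cis h)" for h
  proof -
    define c b where "c = cis h" and "b = cis (-h)"
    have cb: "c * b = 1" by (simp add: c_def b_def cis_mult)
    have n: "1 - of_real r * c \<noteq> 0" "1 - of_real r * b \<noteq> 0" using nz[of c] nz[of b] by (simp_all add: c_def b_def)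
    have "c - of_real r = c * (1 - of_real r * b)" using cb by (simp add: algebra_simps)
    moreover have "c \<noteq> 0" by (simp add: c_def)
    ultimately have "K c / (c - of_real r) * c = K c * (1 / (1 - of_real r * b))"
      "K2 c / c * c = K c * (of_real r * c / (1 - of_real r * c))"
      unfolding K2_def using n by simp_all
    moreover have "(A * \<i> * c + B * \<i> * c) * (-\<i>) = A * c + B * c" for A B
      by (simp add: complex_eq_iff algebra_simps)
    ultimately have "(K c / (c - of_real r) * \<i> * c + K2 c / c * \<i> * c) * (-\<i>)
       = K c * (1 / (1 - of_real r * b) + of_real r * c / (1 - of_real r * c))"
      by (simp only: distrib_left)
    also have "1 / (1 - of_real r * b) + of_real r * c / (1 - of_real r * c)
       = (1 - of_real r * of_real r * (c * b)) / ((1 - of_real r * c) * (1 - of_real r * b))"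
      using n by (simp add: field_simps)
    also have "\<dots> = of_real ((1 - r\<^sup>2) / poisson_denom r h)"
      unfolding of_real_divide poisson_denom_factor cb by (simp add: c_def b_def power2_eq_square)
    finally show ?thesis by (simp add: c_def scaleR_conv_of_real mult.commute)
  qed
  have "((\<lambda>h. (K (cis h) / (cis h - of_real r) * \<i> * cis h + K2 (cis h) / cis h * \<i> * cis h) * (-\<i>))
     has_integral (2 * of_real pi * \<i> * K (of_real r) + 0) * (-\<i>)) {0..2*pi}"
    by (intro has_integral_mult_left has_integral_add 1 2)
  then show ?thesis unfolding eq by (simp add: scaleR_conv_of_real algebra_simps)
qed

lemma poisson_kernel_integral:
  assumes "0 \<le> r" "r < 1"
  shows "((\<lambda>h. (1 - r\<^sup>2) / poisson_denom r h) has_integral 2*pi) {0..2*pi}"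
proof -
  have "((\<lambda>h. Re (((1 - r\<^sup>2) / poisson_denom r h) *\<^sub>R 1)) has_integral Re ((2*pi) *\<^sub>R 1)) {0..2*pi}"
    using has_integral_linear[OF poisson_integral_holomorphic[of "\<lambda>z. 1" r] bounded_linear_Re] assms
    by (simp add: o_def)
  then show ?thesis by simp
qed

text \<open>The holomorphic parts \<open>H\<close> and \<open>G\<close> may fail to extend
  continuously to the circle. The formula is therefore applied to the dilation of f by x < 1, and x
  then tends to 1, where only the continuity of f itself enters.\<close>

lemma poisson_integral_harmonic:
  assumes harm: "harmonic_on f (ball 0 1)" and cont: "continuous_on (cball 0 1) f" and r: "0 \<le> r" "r < 1"
  shows "integral {0..2*pi} (\<lambda>h. ((1 - r\<^sup>2) / poisson_denom r h) *\<^sub>R f (cis (t + h))) = (2*pi) *\<^sub>R f (of_real r * cis t)"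
proof -
  obtain H G where H: "H holomorphic_on ball 0 1" and G: "G holomorphic_on ball 0 1"
    and f: "\<And>z. z \<in> ball 0 1 \<Longrightarrow> f z = H z + cnj (G z)"
    using harmonic_on_holomorphic_decomposition[OF harm] by blast
  have scaled: "((\<lambda>h. ((1 - r\<^sup>2) / poisson_denom r h) *\<^sub>R K (of_real x * cis (t + h))) has_integral
      (2*pi) *\<^sub>R K (of_real x * (of_real r * cis t))) {0..2*pi}"
    if K: "K holomorphic_on ball 0 1" and x: "0 \<le> x" "x < 1" for K x
  proof -
    have im: "of_real x * cis t * z \<in> ball 0 1" if "z \<in> cball 0 1" for z
    proof -
      have "norm (of_real x * cis t * z) \<le> x * 1"
        unfolding norm_mult using x that by (simp add: mult_left_le)
      then show ?thesis using x by simp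
    qed
    have *: "(\<lambda>z. K (of_real x * cis t * z)) holomorphic_on cball 0 1"
      using holomorphic_on_compose_gen[OF _ K, of "\<lambda>z. of_real x * cis t * z" "cball 0 1"] im
      by (force simp: o_def intro!: holomorphic_intros)
    from poisson_integral_holomorphic[OF holomorphic_on_imp_continuous_on[OF *] holomorphic_on_subset[OF *] r]
    show ?thesis by (simp add: ball_subset_cball cis_mult[symmetric] mult_ac)
  qed
  have inner: "integral {0..2*pi} (\<lambda>h. ((1 - r\<^sup>2) / poisson_denom r h) *\<^sub>R f (of_real x * cis (t + h)))
      = (2*pi) *\<^sub>R f (of_real x * (of_real r * cis t))" if x: "0 \<le> x" "x < 1" for x
  proof (rule integral_unique)
    have "((\<lambda>h. ((1 - r\<^sup>2) / poisson_denom r h) *\<^sub>R H (of_real x * cis (t + h)) +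
          cnj (((1 - r\<^sup>2) / poisson_denom r h) *\<^sub>R G (of_real x * cis (t + h)))) has_integral
      (2*pi) *\<^sub>R H (of_real x * (of_real r * cis t)) + cnj ((2*pi) *\<^sub>R G (of_real x * (of_real r * cis t)))) {0..2*pi}"
      using has_integral_linear[OF scaled[OF G x] bounded_linear_cnj]
      by (intro has_integral_add scaled[OF H x]) (simp add: o_def)
    moreover have "norm (of_real x * (of_real r * cis t)) < 1"
      using x r by (simp add: norm_mult) (metis mult_le_one less_eq_real_def mult_strict_mono' mult_1 linorder_not_less)
    ultimately show "((\<lambda>h. ((1 - r\<^sup>2) / poisson_denom r h) *\<^sub>R f (of_real x * cis (t + h))) has_integral
      (2*pi) *\<^sub>R f (of_real x * (of_real r * cis t))) {0..2*pi}"
      using x by (simp add: f norm_mult scaleR_add_right)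
  qed
  define F where "F x = integral {0..2*pi} (\<lambda>h. ((1 - r\<^sup>2) / poisson_denom r h) *\<^sub>R f (of_real x * cis (t + h)))" for x
  define F' where "F' x = (2*pi) *\<^sub>R f (of_real x * (of_real r * cis t))" for x
  have "F 1 = F' 1"
  proof (rule continuous_on_eq_at_right_end[where a=0])
    have "continuous_on ({0..1::real} \<times> cbox 0 (2*pi))
        (\<lambda>(x,h). ((1 - r\<^sup>2) / poisson_denom r h) *\<^sub>R f (of_real x * cis (t + h)))"
      unfolding case_prod_beta
      using poisson_denom_pos[OF r]
      by (intro continuous_intros continuous_on_compose2[OF cont]) (auto simp: norm_mult less_imp_neq[symmetric])
    from integral_continuous_on_param[OF this]
    show "continuous_on {0..1} F"
      by (simp add: F_def[abs_def])
    have "norm (of_real x * (of_real r * cis t)) \<le> 1" if "x \<in> {0..1}" for x :: real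
      using r that mult_le_one[of x r] by (simp add: norm_mult)
    then show "continuous_on {0..1} F'"
      unfolding F'_def[abs_def]
      by (intro continuous_intros continuous_on_compose2[OF cont]) auto
  qed (use inner in \<open>auto simp: F_def F'_def\<close>)
  then show ?thesis by (simp add: F_def F'_def)
qed

subsection \<open>Dirichlet energy\<close>

lemma continuous_on_hs_norm2 [continuous_intros]:
  "continuous_on A L \<Longrightarrow> continuous_on A (\<lambda>x. hs_norm2 (L x))"
  unfolding hs_norm2_eq by (intro continuous_intros)

text \<open>The Hilbert-Schmidt norm is the same in every orthonormal frame; the polar frame
  \<open>cis t\<close>, \<open>\<i> * cis t\<close> is the one used below.\<close>

lemma hs_norm2_rotate:
  fixes L :: "complex \<Rightarrow>\<^sub>L complex"
  shows "(norm (L (cis t)))\<^sup>2 + (norm (L (\<i> * cis t)))\<^sup>2 = hs_norm2 L"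
proof -
  define a b where "a = L 1" and "b = L \<i>"
  have L: "L w = Re w *\<^sub>R a + Im w *\<^sub>R b" for w
    unfolding a_def b_def by (rule blinfun_complex_expand)
  define c s where "c = cos t" and "s = sin t"
  have "(norm (L (cis t)))\<^sup>2 + (norm (L (\<i> * cis t)))\<^sup>2 = (c * c + s * s) * ((norm a)\<^sup>2 + (norm b)\<^sup>2)"
    unfolding L cmod_power2
    by (simp add: c_def[symmetric] s_def[symmetric] power2_eq_square algebra_simps)
  then show ?thesis by (simp add: hs_norm2_eq a_def b_def c_def s_def)
qed

text \<open>The Laplacian is a trace, so it too can be computed in the polar frame.\<close>

lemma laplacian_rotate:
  fixes B :: "complex \<Rightarrow>\<^sub>L (complex \<Rightarrow>\<^sub>L complex)"
  assumes "B 1 1 + B \<i> \<i> = 0"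
  shows "B (cis t) (cis t) + B (\<i> * cis t) (\<i> * cis t) = 0"
proof -
  have B: "B v w = (Re v * Re w) *\<^sub>R B 1 1 + (Re v * Im w) *\<^sub>R B 1 \<i>
       + (Im v * Re w) *\<^sub>R B \<i> 1 + (Im v * Im w) *\<^sub>R B \<i> \<i>" for v w
    unfolding blinfun_complex_expand[of B v] blinfun.add_left blinfun.scaleR_left
      blinfun_complex_expand[of "B 1" w] blinfun_complex_expand[of "B \<i>" w]
    by (simp only: scaleR_add_right scaleR_scaleR ac_simps)
  define c s where "c = cos t" and "s = sin t"
  have "B (cis t) (cis t) + B (\<i> * cis t) (\<i> * cis t) = (c * c + s * s) *\<^sub>R (B 1 1 + B \<i> \<i>)"
    unfolding B[of "cis t"] B[of "\<i> * cis t"]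
    by (simp add: c_def[symmetric] s_def[symmetric] algebra_simps)
  then show ?thesis by (simp add: assms)
qed

text \<open>
  With \<open>g(r, t) = f(r cis t)\<close>, harmonicity gives
  \<open>\<partial>\<^sub>r (r (g \<bullet> g\<^sub>r)) + \<partial>\<^sub>t (g \<bullet> g\<^sub>t / r) = r |Df|\<^sup>2\<close>; the second term integrates to \<open>0\<close> over a
  period. Below \<open>P\<close> and \<open>Q\<close> are the two fluxes, and \<open>Q\<close> has no singularity at \<open>r = 0\<close>.
\<close>

lemma harmonic_energy_subdisc:
  fixes f :: "complex \<Rightarrow> complex" and Df :: "complex \<Rightarrow> complex \<Rightarrow>\<^sub>L complex"
    and D2 :: "complex \<Rightarrow> complex \<Rightarrow>\<^sub>L complex \<Rightarrow>\<^sub>L complex"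
  assumes d1: "\<And>z. z \<in> ball 0 1 \<Longrightarrow> (f has_derivative Df z) (at z)"
    and d2: "\<And>z. z \<in> ball 0 1 \<Longrightarrow> (Df has_derivative D2 z) (at z)"
    and D2: "continuous_on (ball 0 1) D2"
    and lap: "\<And>z. z \<in> ball 0 1 \<Longrightarrow> D2 z 1 1 + D2 z \<i> \<i> = 0"
    and \<rho>: "0 \<le> \<rho>" "\<rho> < 1"
  shows "integral {0..\<rho>} (\<lambda>r. integral {0..2*pi} (\<lambda>t. r * hs_norm2 (Df (of_real r * cis t))))
    = integral {0..2*pi} (\<lambda>t. \<rho> * inner (f (of_real \<rho> * cis t)) (Df (of_real \<rho> * cis t) (cis t)))"
proof -
  define z where "z r t = of_real r * cis t" for r t
  have z_ball: "z r t \<in> ball 0 1" if "r \<in> {0..\<rho>}" for r t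
    unfolding z_def using that \<rho> by (simp add: norm_mult)
  have f_cont: "continuous_on (ball 0 1) f" and Df_cont: "continuous_on (ball 0 1) Df"
    using d1 d2 by (meson has_derivative_at_withinI has_derivative_continuous_on)+
  define P where "P r t = r * inner (f (z r t)) (Df (z r t) (cis t))" for r t
  define p where "p r t = r * (inner (f (z r t)) (D2 (z r t) (cis t) (cis t)) + inner (Df (z r t) (cis t)) (Df (z r t) (cis t)))
     + inner (f (z r t)) (Df (z r t) (cis t))" for r t
  define Q where "Q r t = inner (f (z r t)) (Df (z r t) (\<i> * cis t))" for r t
  define q where "q r t = inner (f (z r t)) (Df (z r t) (- cis t) + D2 (z r t) (r *\<^sub>R (\<i> * cis t)) (\<i> * cis t))
     + inner (Df (z r t) (r *\<^sub>R (\<i> * cis t))) (Df (z r t) (\<i> * cis t))" for r t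
  have sum: "p r t + q r t = r * hs_norm2 (Df (z r t))" if "r \<in> {0..\<rho>}" for r t
  proof -
    \<comment> \<open>The term \<open>Df (z r t) (- cis t)\<close> in \<open>q\<close>, which comes
      from differentiating \<open>\<i> * cis t\<close>, cancels the summand of \<open>p\<close>
      without the factor \<open>r\<close>. What remains is a Laplacian and a Hilbert-Schmidt norm in
      the polar frame.\<close>
    have "p r t + q r t = r * inner (f (z r t)) (D2 (z r t) (cis t) (cis t) + D2 (z r t) (\<i> * cis t) (\<i> * cis t))
      + r * ((norm (Df (z r t) (cis t)))\<^sup>2 + (norm (Df (z r t) (\<i> * cis t)))\<^sup>2)"
      unfolding p_def q_def power2_norm_eq_inner
      by (simp add: blinfun.scaleR_right blinfun.scaleR_left blinfun.minus_right inner_add_right algebra_simps)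
    then show ?thesis
      by (simp only: laplacian_rotate[OF lap[OF z_ball[OF that]]] hs_norm2_rotate) simp
  qed
  have dP: "((\<lambda>r. P r t) has_vector_derivative p r t) (at r within {0..\<rho>})" if r: "r \<in> {0..\<rho>}" for r t
  proof -
    have z': "((\<lambda>r. z r t) has_derivative (\<lambda>h. h *\<^sub>R cis t)) (at r within {0..\<rho>})"
      unfolding z_def by (auto intro!: derivative_eq_intros simp: scaleR_conv_of_real)
    have 1: "((\<lambda>r. f (z r t)) has_vector_derivative Df (z r t) (cis t)) (at r within {0..\<rho>})"
      using has_derivative_compose[OF z' d1[OF z_ball[OF r]]]
      by (simp add: has_vector_derivative_def blinfun.scaleR_right)
    have 2: "((\<lambda>r. Df (z r t) (cis t)) has_vector_derivative D2 (z r t) (cis t) (cis t)) (at r within {0..\<rho>})"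
      using bounded_linear.has_derivative[OF blinfun.bounded_linear_left has_derivative_compose[OF z' d2[OF z_ball[OF r]]]]
      by (simp add: has_vector_derivative_def blinfun.scaleR_right blinfun.scaleR_left)
    have 3: "((\<lambda>r. r) has_vector_derivative 1) (at r within {0..\<rho>})" by (rule has_vector_derivative_id)
    show ?thesis unfolding P_def p_def
      using bounded_bilinear.has_vector_derivative[OF bounded_bilinear_mult 3
          bounded_bilinear.has_vector_derivative[OF bounded_bilinear_inner 1 2]] by simp
  qed
  have dQ: "((\<lambda>t. Q r t) has_vector_derivative q r t) (at t within {0..2*pi})" if r: "r \<in> {0..\<rho>}" for r t
  proof -
    have e: "((\<lambda>t. \<i> * cis t) has_vector_derivative - cis t) (at t within {0..2*pi})"
      unfolding has_vector_derivative_def by (auto intro!: derivative_eq_intros)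
    have z': "((\<lambda>t. z r t) has_derivative (\<lambda>h. h *\<^sub>R (r *\<^sub>R (\<i> * cis t)))) (at t within {0..2*pi})"
      unfolding z_def by (auto intro!: derivative_eq_intros simp: scaleR_conv_of_real)
    have 1: "((\<lambda>t. f (z r t)) has_vector_derivative Df (z r t) (r *\<^sub>R (\<i> * cis t))) (at t within {0..2*pi})"
      using has_derivative_compose[OF z' d1[OF z_ball[OF r]]]
      by (simp add: has_vector_derivative_def blinfun.scaleR_right)
    have 2: "((\<lambda>t. Df (z r t)) has_vector_derivative D2 (z r t) (r *\<^sub>R (\<i> * cis t))) (at t within {0..2*pi})"
      using has_derivative_compose[OF z' d2[OF z_ball[OF r]]]
      by (simp add: has_vector_derivative_def blinfun.scaleR_right)
    show ?thesis unfolding Q_def q_def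
      by (rule bounded_bilinear.has_vector_derivative[OF bounded_bilinear_inner 1
          bounded_bilinear.has_vector_derivative[OF bounded_bilinear_blinfun_apply 2 e]])
  qed
  note comp = continuous_on_compose2[OF f_cont] continuous_on_compose2[OF Df_cont] continuous_on_compose2[OF D2]
  have cont: "continuous_on ({0..\<rho>} \<times> {0..2*pi}) (\<lambda>x. p (fst x) (snd x))"
     "continuous_on ({0..\<rho>} \<times> {0..2*pi}) (\<lambda>x. q (fst x) (snd x))"
    unfolding p_def q_def
    by (intro continuous_intros comp; use z_ball in \<open>auto simp: z_def intro!: continuous_intros\<close>)+
  have int: "p r integrable_on {0..2*pi}" "q r integrable_on {0..2*pi}" if r: "r \<in> {0..\<rho>}" for r
    by (rule integrable_continuous_interval, rule continuous_on_slice[OF _ r], rule cont)+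
  have "integral {0..\<rho>} (\<lambda>r. integral {0..2*pi} (\<lambda>t. r * hs_norm2 (Df (z r t))))
      = integral {0..\<rho>} (\<lambda>r. integral {0..2*pi} (\<lambda>t. p r t))"
  proof (rule integral_cong)
    fix r assume r: "r \<in> {0..\<rho>}"
    have "integral {0..2*pi} (\<lambda>t. r * hs_norm2 (Df (z r t))) = integral {0..2*pi} (\<lambda>t. p r t + q r t)"
      by (simp add: sum[OF r])
    also have "\<dots> = integral {0..2*pi} (\<lambda>t. p r t) + integral {0..2*pi} (\<lambda>t. q r t)"
      by (rule integral_add[OF int[OF r]])
    also have "integral {0..2*pi} (\<lambda>t. q r t) = Q r (2*pi) - Q r 0"
      by (intro integral_unique fundamental_theorem_of_calculus dQ r) auto
    also have "\<dots> = 0" by (simp add: Q_def z_def)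
    finally show "integral {0..2*pi} (\<lambda>t. r * hs_norm2 (Df (z r t))) = integral {0..2*pi} (\<lambda>t. p r t)" by simp
  qed
  also have "\<dots> = integral {0..2*pi} (\<lambda>t. integral {0..\<rho>} (\<lambda>r. p r t))"
    using integral_swap_continuous[of 0 0 \<rho> "2*pi" p] cont(1) by (simp add: case_prod_beta cbox_Pair_eq)
  also have "\<dots> = integral {0..2*pi} (\<lambda>t. P \<rho> t)"
  proof (rule integral_cong)
    fix t
    have "integral {0..\<rho>} (\<lambda>r. p r t) = P \<rho> t - P 0 t"
      by (intro integral_unique fundamental_theorem_of_calculus dP \<rho>) auto
    then show "integral {0..\<rho>} (\<lambda>r. p r t) = P \<rho> t" by (simp add: P_def)
  qed
  finally show ?thesis by (simp add: P_def z_def)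
qed

text \<open>Second derivatives are available only inside the disc, but both sides of the identity on
  smaller discs involve first derivatives alone. These are continuous up to the circle, so the
  radius may tend to 1.\<close>

lemma harmonic_energy:
  fixes f :: "complex \<Rightarrow> complex" and Df :: "complex \<Rightarrow> complex \<Rightarrow>\<^sub>L complex"
  assumes harm: "harmonic_on f (ball 0 1)"
    and deriv: "\<And>z. z \<in> cball 0 1 \<Longrightarrow> (f has_derivative Df z) (at z within cball 0 1)"
    and C1: "continuous_on (cball 0 1) Df"
  shows "integral (ball 0 1) (\<lambda>z. hs_norm2 (Df z)) = integral {0..2*pi} (\<lambda>t. inner (f (cis t)) (Df (cis t) (cis t)))"
proof -
  from harm obtain D1 D2 where D1: "\<And>z. z \<in> ball 0 1 \<Longrightarrow> (f has_derivative blinfun_apply (D1 z)) (at z)"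
    and D2: "\<And>z. z \<in> ball 0 1 \<Longrightarrow> (D1 has_derivative blinfun_apply (D2 z)) (at z)"
    and cont: "continuous_on (ball 0 1) D2"
    and lap: "\<And>z. z \<in> ball 0 1 \<Longrightarrow> D2 z 1 1 + D2 z \<i> \<i> = 0"
    unfolding harmonic_on_def by blast
  \<comment> \<open>The derivative provided by \<open>harmonic_on\<close> is a bound witness;
    uniqueness of derivatives identifies it with \<open>Df\<close> at interior points.\<close>
  have D1_eq: "D1 z = Df z" if z: "z \<in> ball 0 1" for z
  proof -
    have "z \<in> interior (cball 0 1)" using z by simp
    then have "(f has_derivative Df z) (at z)"
      using deriv[of z] z at_within_interior[of z "cball 0 1"] by simp
    with D1[OF z] have "blinfun_apply (D1 z) = blinfun_apply (Df z)" by (rule has_derivative_unique)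
    then show ?thesis by (simp add: blinfun_apply_inject)
  qed
  have d1: "(f has_derivative Df z) (at z)" if "z \<in> ball 0 1" for z
    using D1[OF that] D1_eq[OF that] by simp
  have d2: "(Df has_derivative D2 z) (at z)" if "z \<in> ball 0 1" for z
    by (rule has_derivative_transform_within_open[OF D2[OF that] open_ball that]) (simp add: D1_eq)
  have f_cont: "continuous_on (cball 0 1) f" using deriv by (rule has_derivative_continuous_on)
  define F where "F \<rho> = integral {0..\<rho>} (\<lambda>r. integral {0..2*pi} (\<lambda>t. r * hs_norm2 (Df (of_real r * cis t))))" for \<rho>
  define G where "G \<rho> = integral {0..2*pi} (\<lambda>t. \<rho> * inner (f (of_real \<rho> * cis t)) (Df (of_real \<rho> * cis t) (cis t)))" for \<rho>
  have "F 1 = G 1"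
  proof (rule continuous_on_eq_at_right_end[where a=0 and F=F and G=G])
    show "F \<rho> = G \<rho>" if "0 \<le> \<rho>" "\<rho> < 1" for \<rho>
      unfolding F_def G_def by (rule harmonic_energy_subdisc[OF d1 d2 cont lap that])
    have "continuous_on ({0..1::real} \<times> cbox 0 (2*pi)) (\<lambda>(r,t). r * hs_norm2 (Df (of_real r * cis t)))"
      unfolding case_prod_beta
      by (intro continuous_intros continuous_on_compose2[OF C1]) (auto simp: norm_mult)
    from integral_continuous_on_param[OF this]
    have "(\<lambda>r. integral {0..2*pi} (\<lambda>t. r * hs_norm2 (Df (of_real r * cis t)))) integrable_on {0..1}"
      by (intro integrable_continuous_interval) simp
    then show "continuous_on {0..1} F" unfolding F_def[abs_def] by (rule indefinite_integral_continuous_1)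
    have "continuous_on ({0..1::real} \<times> cbox 0 (2*pi))
        (\<lambda>(\<rho>,t). \<rho> * inner (f (of_real \<rho> * cis t)) (Df (of_real \<rho> * cis t) (cis t)))"
      unfolding case_prod_beta
      by (intro continuous_intros continuous_on_compose2[OF C1] continuous_on_compose2[OF f_cont]) (auto simp: norm_mult)
    from integral_continuous_on_param[OF this] show "continuous_on {0..1} G" by (simp add: G_def[abs_def])
  qed simp
  moreover have "integral (ball 0 1) (\<lambda>z. hs_norm2 (Df z)) = F 1"
    unfolding F_def by (rule integral_ball_polar) (intro continuous_intros C1)
  ultimately show ?thesis by (simp add: G_def)
qed

subsection \<open>Integration by parts against the Poisson kernel\<close>

text \<open>
  The numerator left over by \<open>poisson_by_parts\<close> below; with \<open>p = h + d\<close> it takes the form of \<open>chord_gap_add\<close>.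
\<close>

definition chord_gap :: "real \<Rightarrow> real \<Rightarrow> real" where
  "chord_gap h p = sin h * (p - sin p - h + sin h) - (1 - cos h) * (cos h - cos p)"

lemma chord_gap_add:
  "chord_gap h (h + d) = (1 - cos h) * (1 - cos d) + sin h * (d - sin d)"
  unfolding chord_gap_def sin_add cos_add
  by (simp add: algebra_simps) (metis distrib_left mult_1_right sin_cos_squared_add3)

lemma chord_gap_reflect: "chord_gap (2 * pi - h) (2 * pi - p) = chord_gap h p"
  unfolding chord_gap_def sin_2pi_minus cos_2pi_minus by (simp add: algebra_simps)

lemma cos_less_1:
  assumes "x \<noteq> 0" "\<bar>x\<bar> < 2 * pi"
  shows "cos x < 1"
proof -
  have "sin (\<bar>x\<bar> / 2) > 0" using assms by (intro sin_gt_zero) auto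
  moreover have "cos \<bar>x\<bar> = 1 - 2 * (sin (\<bar>x\<bar> / 2))\<^sup>2"
    using cos_double_sin[of "\<bar>x\<bar> / 2"] by simp
  ultimately show ?thesis by simp
qed

lemma mult_cos_less_sin:
  assumes "0 < y" "y < pi"
  shows "y * cos y < sin y"
proof -
  have "(\<lambda>y. sin y - y * cos y) 0 < (\<lambda>y. sin y - y * cos y) y"
  proof (rule DERIV_pos_imp_increasing_open[OF assms(1)])
    fix x assume x: "0 < x" "x < y"
    have "((\<lambda>y. sin y - y * cos y) has_real_derivative x * sin x) (at x)"
      by (auto intro!: derivative_eq_intros)
    moreover have "x * sin x > 0" using x assms by (intro mult_pos_pos sin_gt_zero) auto
    ultimately show "\<exists>d. ((\<lambda>y. sin y - y * cos y) has_real_derivative d) (at x) \<and> 0 < d" by blast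
  qed (intro continuous_intros)
  then show ?thesis by simp
qed

text \<open>This is the case d = -x < 0 of \<open>chord_gap_add\<close>, where the two summands
  compete. In half angles the expression is a positive multiple of S (2 s^2) - C (x - 2 s c). Since
  x \<le> h, the cotangent C / S is at most c / s, and the extreme value reduces the claim to x
  cos(x/2) < 2 sin(x/2).\<close>

lemma chord_gap_pos_aux:
  assumes h: "0 < h" "h < pi" and x: "0 < x" "x \<le> h"
  shows "0 < (1 - cos h) * (1 - cos x) - sin h * (x - sin x)"
proof -
  define S C s c where "S = sin (h/2)" and "C = cos (h/2)" and "s = sin (x/2)" and "c = cos (x/2)"
  have pos: "S > 0" "C > 0" "s > 0" "c > 0"
    using h x by (auto simp: S_def C_def s_def c_def intro!: sin_gt_zero cos_gt_zero)
  have H: "cos h = 1 - 2 * S\<^sup>2" "sin h = 2 * S * C" "cos x = 1 - 2 * s\<^sup>2" "sin x = 2 * s * c"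
    using cos_double_sin[of "h/2"] sin_double[of "h/2"] cos_double_sin[of "x/2"] sin_double[of "x/2"]
    by (simp_all add: S_def C_def s_def c_def)
  have sc: "s\<^sup>2 + c\<^sup>2 = 1" by (simp add: s_def c_def)
  have "S * c - C * s = sin (h/2 - x/2)" by (simp add: sin_diff S_def C_def s_def c_def)
  also have "\<dots> \<ge> 0" using h x by (intro sin_ge_zero) auto
  finally have le: "C * s \<le> S * c" by simp
  have "x / 2 * c < s" unfolding c_def s_def using h x by (intro mult_cos_less_sin) auto
  then have lt: "x * c < 2 * s" by simp
  have "0 < C * (2 * s - x * c)" using lt pos by simp
  also have "2 * s - x * c = 2 * s * (s\<^sup>2 + c\<^sup>2) - x * c" by (simp add: sc)
  also have "C * (2 * s * (s\<^sup>2 + c\<^sup>2) - x * c) = C * s * (2 * s\<^sup>2) - C * c * (x - 2 * s * c)"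
    by (simp add: algebra_simps power2_eq_square)
  also have "\<dots> \<le> S * c * (2 * s\<^sup>2) - C * c * (x - 2 * s * c)"
    using le by (intro diff_right_mono mult_right_mono) auto
  also have "\<dots> = c * (S * (2 * s\<^sup>2) - C * (x - 2 * s * c))" by (simp add: algebra_simps)
  finally have "0 < S * (2 * s\<^sup>2) - C * (x - 2 * s * c)" using pos by (simp add: zero_less_mult_iff)
  then have "0 < 2 * S * (S * (2 * s\<^sup>2) - C * (x - 2 * s * c))" using pos by simp
  also have "\<dots> = (1 - cos h) * (1 - cos x) - sin h * (x - sin x)"
    unfolding H by (simp add: algebra_simps power2_eq_square)
  finally show ?thesis .
qed

text \<open>By reflection one may take h \<le> pi, so that sin h \<ge> 0. With d = p - h, the first
  summand in \<open>chord_gap_add\<close> is positive because 0 < |d| < 2 pi; the second is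
  nonnegative for d > 0 and vanishes for h = pi. Only d < 0 needs the finer estimate above.\<close>

lemma chord_gap_pos:
  assumes h: "0 < h" "h < 2 * pi" and p: "0 \<le> p" "p \<le> 2 * pi" "p \<noteq> h"
  shows "0 < chord_gap h p"
proof -
  have *: "0 < chord_gap h p" if h: "0 < h" "h \<le> pi" and p: "0 \<le> p" "p \<le> 2 * pi" "p \<noteq> h" for h p
  proof -
    define d where "d = p - h"
    have p_eq: "p = h + d" by (simp add: d_def)
    have "cos d < 1" using h p by (intro cos_less_1) (auto simp: d_def)
    moreover have "cos h < 1" using h pi_gt_zero by (intro cos_less_1) linarith+
    ultimately have pos: "0 < (1 - cos h) * (1 - cos d)" by simp
    consider "h = pi" | "0 < d" "h < pi" | "d < 0" "h < pi" using h p by (force simp: d_def)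
    then show ?thesis
    proof cases
      case 1
      then show ?thesis using pos by (simp add: p_eq chord_gap_add)
    next
      case 2
      then have "0 \<le> sin h * (d - sin d)" using h sin_x_le_x[of d] by (simp add: sin_ge_zero)
      then show ?thesis using pos by (simp add: p_eq chord_gap_add)
    next
      case 3
      have "-d \<le> h" using p by (simp add: d_def)
      then have "0 < (1 - cos h) * (1 - cos (-d)) - sin h * (-d - sin (-d))"
        using 3 h by (intro chord_gap_pos_aux) auto
      then show ?thesis unfolding p_eq chord_gap_add by (simp add: algebra_simps)
    qed
  qed
  show ?thesis
  proof (cases "h \<le> pi")
    case True
    then show ?thesis using * h p by simp
  next
    case False
    then have "0 < chord_gap (2 * pi - h) (2 * pi - p)" using h p by (intro *) auto
    then show ?thesis by (simp add: chord_gap_reflect)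
  qed
qed

lemma chord_gap_nonneg:
  assumes h: "0 \<le> h" "h \<le> 2 * pi" and p: "0 \<le> p" "p \<le> 2 * pi"
  shows "0 \<le> chord_gap h p"
proof -
  consider "h = 0" | "h = 2 * pi" | "p = h" | "0 < h" "h < 2 * pi" "p \<noteq> h" using h by force
  then show ?thesis
    by cases (use chord_gap_pos[of h p] p in \<open>auto simp: chord_gap_def\<close>)
qed

lemma continuous_on_chord_gap [continuous_intros]:
  fixes A :: "'a::t2_space set"
  shows "continuous_on A k \<Longrightarrow> continuous_on A l \<Longrightarrow> continuous_on A (\<lambda>x. chord_gap (k x) (l x))"
  unfolding chord_gap_def by (intro continuous_intros)

text \<open>Up to the term cos h - cos \<Phi>, the factor (W - 1) (1 - cos \<Phi>) is the derivative
  of \<Phi> - sin \<Phi> - (h - sin h). Integration by parts moves that derivative onto the kernel,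
  whose derivative brings in the square of the denominator.\<close>

lemma poisson_by_parts:
  fixes \<Phi> W :: "real \<Rightarrow> real"
  assumes r: "0 \<le> r" "r < 1"
    and \<Phi>: "\<And>h. h \<in> {0..2*pi} \<Longrightarrow> (\<Phi> has_real_derivative W h) (at h within {0..2*pi})"
    and W: "continuous_on {0..2*pi} W"
    and ends: "\<Phi> 0 = 0" "\<Phi> (2*pi) = 2*pi"
  shows "integral {0..2*pi} (\<lambda>h. (1 + r) / poisson_denom r h * ((W h - 1) * (1 - cos (\<Phi> h))))
    = integral {0..2*pi} (\<lambda>h. (1 + r) / (poisson_denom r h)\<^sup>2 *
        (2 * r * chord_gap h (\<Phi> h) - (1 - r)\<^sup>2 * (cos h - cos (\<Phi> h))))"
    (is "integral _ ?A = integral _ ?B")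
proof -
  note D = poisson_denom_pos[OF r]
  have \<Phi>_cont: "continuous_on {0..2*pi} \<Phi>" using \<Phi> by (rule DERIV_continuous_on)
  \<comment> \<open>Subtracting h - sin h makes \<open>E\<close> vanish at both ends of the period,
    so no boundary terms arise.\<close>
  define E where "E h = \<Phi> h - sin (\<Phi> h) - (h - sin h)" for h
  define k where "k h = (1 + r) / poisson_denom r h" for h
  have "((\<lambda>h. k h * E h) has_real_derivative (?A h - ?B h)) (at h within {0..2*pi})" if h: "h \<in> {0..2*pi}" for h
  proof -
    have E: "(E has_real_derivative W h * (1 - cos (\<Phi> h)) - (1 - cos h)) (at h within {0..2*pi})"
      unfolding E_def by (auto intro!: derivative_eq_intros \<Phi>[OF h]) (simp add: algebra_simps)
    have d: "(poisson_denom r has_real_derivative 2 * r * sin h) (at h within {0..2*pi})"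
      unfolding poisson_denom_def[abs_def] by (auto intro!: derivative_eq_intros)
    have k: "(k has_real_derivative - ((1 + r) * (2 * r * sin h) / (poisson_denom r h)\<^sup>2)) (at h within {0..2*pi})"
      unfolding k_def using D[of h]
      by (auto intro!: derivative_eq_intros d simp: power2_eq_square)
    have "- ((1 + r) * (2 * r * sin h) / (poisson_denom r h)\<^sup>2) * E h + (W h * (1 - cos (\<Phi> h)) - (1 - cos h)) * k h
       = ?A h - ?B h"
    proof -
      define q where "q = poisson_denom r h"
      have q: "q \<noteq> 0" using D[of h] by (simp add: q_def)
      define a b where "a = cos h" and "b = cos (\<Phi> h)"
      \<comment> \<open>Splitting the denominator into (1 - r)^2 and 2 r (1 - cos h) separates
        \<open>chord_gap\<close> from a remainder that carries the factor (1 - r)^2.\<close>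
      have q_eq: "(1 - r)\<^sup>2 = q - 2 * r * (1 - a)"
        by (simp add: q_def poisson_denom_def a_def power2_eq_square algebra_simps)
      have "2 * r * chord_gap h (\<Phi> h) - (1 - r)\<^sup>2 * (a - b) = 2 * r * sin h * E h - q * (a - b)"
        unfolding q_eq by (simp add: chord_gap_def E_def a_def b_def algebra_simps)
      then have B: "?B h = (1 + r) / q\<^sup>2 * (2 * r * sin h * E h) - (1 + r) / q * (a - b)"
        using q by (simp add: q_def[symmetric] a_def[symmetric] b_def[symmetric] right_diff_distrib power2_eq_square)
      show ?thesis unfolding B
        by (simp add: k_def q_def[symmetric] a_def[symmetric] b_def[symmetric] algebra_simps add_divide_distrib diff_divide_distrib)
    qed
    with DERIV_mult[OF k E] show ?thesis by simp
  qed
  then have "((\<lambda>h. ?A h - ?B h) has_integral (k (2*pi) * E (2*pi) - k 0 * E 0)) {0..2*pi}"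
    by (intro fundamental_theorem_of_calculus) (auto simp: has_real_derivative_iff_has_vector_derivative)
  then have "integral {0..2*pi} (\<lambda>h. ?A h - ?B h) = 0"
    by (simp add: E_def ends integral_unique)
  moreover have "?A integrable_on {0..2*pi}" "?B integrable_on {0..2*pi}"
    using D by (auto intro!: integrable_continuous_interval continuous_intros W \<Phi>_cont simp: less_imp_neq[symmetric])
  ultimately show ?thesis by (simp add: integral_diff)
qed

text \<open>The bound by \<open>M\<close> gains one factor of the denominator in the remainder: cos
  h - cos \<Phi> \<le> M (1 - cos h), and 1 - cos h is at most the denominator once r \<ge> 1/2. The
  remainder is then at most M (1 - r) times the Poisson kernel, whose integral is 2 pi.\<close>

lemma poisson_by_parts_ge:
  fixes \<Phi> W :: "real \<Rightarrow> real"
  assumes r: "1/2 \<le> r" "r < 1"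
    and \<Phi>: "\<And>h. h \<in> {0..2*pi} \<Longrightarrow> (\<Phi> has_real_derivative W h) (at h within {0..2*pi})"
    and W: "continuous_on {0..2*pi} W"
    and ends: "\<Phi> 0 = 0" "\<Phi> (2*pi) = 2*pi"
    and range: "\<And>h. h \<in> {0..2*pi} \<Longrightarrow> \<Phi> h \<in> {0..2*pi}"
    and M: "0 \<le> M" "\<And>h. h \<in> {0..2*pi} \<Longrightarrow> 1 - cos (\<Phi> h) \<le> M * (1 - cos h)"
  shows "integral {0..2*pi} (\<lambda>h. chord_gap h (\<Phi> h)) / 16 - 2 * pi * M * (1 - r)
    \<le> integral {0..2*pi} (\<lambda>h. (1 + r) / poisson_denom r h * ((W h - 1) * (1 - cos (\<Phi> h))))"
proof -
  have r0: "0 \<le> r" using r by simp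
  note D = poisson_denom_pos[OF r0 r(2)]
  have \<Phi>_cont: "continuous_on {0..2*pi} \<Phi>" using \<Phi> by (rule DERIV_continuous_on)
  let ?B = "\<lambda>h. (1 + r) / (poisson_denom r h)\<^sup>2 *
        (2 * r * chord_gap h (\<Phi> h) - (1 - r)\<^sup>2 * (cos h - cos (\<Phi> h)))"
  let ?C = "\<lambda>h. chord_gap h (\<Phi> h) / 16 - M * (1 - r) * ((1 - r\<^sup>2) / poisson_denom r h)"
  have gap: "(\<lambda>h. chord_gap h (\<Phi> h)) integrable_on {0..2*pi}"
    by (intro integrable_continuous_interval continuous_intros \<Phi>_cont)
  have "integral {0..2*pi} ?C = integral {0..2*pi} (\<lambda>h. chord_gap h (\<Phi> h)) / 16 - M * (1 - r) * (2*pi)"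
    by (intro integral_unique has_integral_diff has_integral_divide has_integral_mult_right
        poisson_kernel_integral[OF r0 r(2)] integrable_integral gap)
  moreover have "integral {0..2*pi} ?C \<le> integral {0..2*pi} ?B"
  proof (rule integral_le)
    show "?C integrable_on {0..2*pi}" "?B integrable_on {0..2*pi}"
      using D by (auto intro!: integrable_continuous_interval continuous_intros \<Phi>_cont simp: less_imp_neq[symmetric])
    fix h assume h: "h \<in> {0..2*pi}"
    define q where "q = poisson_denom r h"
    have q: "0 < q" using D[of h] by (simp add: q_def)
    have q_eq: "q = (1 - r)\<^sup>2 + 2 * r * (1 - cos h)"
      by (simp add: q_def poisson_denom_def power2_eq_square algebra_simps)
    have "r * (- cos h) \<le> r * 1"
      using r cos_ge_minus_one[of h] by (intro mult_left_mono) linarith+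
    moreover have "r\<^sup>2 \<le> 1" using r by (intro power_le_one) auto
    ultimately have q4: "q \<le> 4" using r by (simp add: q_def poisson_denom_def)
    define g where "g = chord_gap h (\<Phi> h)"
    have g: "0 \<le> g" using chord_gap_nonneg range[OF h] h by (simp add: g_def)
    have "cos h - cos (\<Phi> h) \<le> M * (1 - cos h)" using M(2)[OF h] cos_le_one[of h] by linarith
    also have "1 - cos h \<le> q"
    proof -
      have "1 * (1 - cos h) \<le> 2 * r * (1 - cos h)" using r by (intro mult_right_mono) auto
      then show ?thesis unfolding q_eq by (intro add_increasing zero_le_power2) (simp only: mult_1)
    qed
    finally have cq: "cos h - cos (\<Phi> h) \<le> M * q" using M(1) by (simp add: mult_left_mono)
    \<comment> \<open>The constant is 4 squared, from q \<le> 4; the factors 1 + r and 2 r are at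
      least 1.\<close>
    have "g / 16 \<le> (1 + r) / q\<^sup>2 * (2 * r * g)"
    proof -
      have "q\<^sup>2 \<le> 4\<^sup>2" using q q4 by (intro power_mono) auto
      then have "1 * q\<^sup>2 \<le> (1 + r) * (2 * r) * 16"
        using r mult_mono[of 1 "1+r" 1 "2*r"] by simp
      then have "g * q\<^sup>2 \<le> g * ((1 + r) * (2 * r) * 16)" using g by (intro mult_left_mono) auto
      then show ?thesis using q by (simp add: field_simps)
    qed
    moreover have "(1 + r) / q\<^sup>2 * ((1 - r)\<^sup>2 * (cos h - cos (\<Phi> h))) \<le> (1 + r) / q\<^sup>2 * ((1 - r)\<^sup>2 * (M * q))"
      using cq r by (intro mult_left_mono) auto
    moreover have "(1 + r) / q\<^sup>2 * ((1 - r)\<^sup>2 * (M * q)) = M * (1 - r) * ((1 - r\<^sup>2) / q)"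
      using q by (simp add: field_simps power2_eq_square)
    ultimately show "?C h \<le> ?B h"
      by (simp add: q_def[symmetric] g_def[symmetric] right_diff_distrib)
  qed
  moreover have "integral {0..2*pi} ?B = integral {0..2*pi} (\<lambda>h. (1 + r) / poisson_denom r h * ((W h - 1) * (1 - cos (\<Phi> h))))"
    by (rule poisson_by_parts[OF r0 r(2) \<Phi> W ends, symmetric])
  ultimately show ?thesis by (simp add: algebra_simps)
qed

subsection \<open>The boundary inequality\<close>

lemma lipschitz_on_disc:
  fixes f :: "complex \<Rightarrow> complex" and Df :: "complex \<Rightarrow> complex \<Rightarrow>\<^sub>L complex"
  assumes deriv: "\<And>z. z \<in> cball 0 1 \<Longrightarrow> (f has_derivative Df z) (at z within cball 0 1)"
    and C1: "continuous_on (cball 0 1) Df"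
  obtains L where "\<And>z w. z \<in> cball 0 1 \<Longrightarrow> w \<in> cball 0 1 \<Longrightarrow> norm (f z - f w) \<le> L * norm (z - w)"
proof -
  have "bounded (Df ` cball 0 1)"
    by (intro compact_imp_bounded compact_continuous_image C1 compact_cball)
  then obtain L where L: "\<And>z. z \<in> cball 0 1 \<Longrightarrow> norm (Df z) \<le> L"
    unfolding bounded_iff by blast
  show thesis
  proof (rule that[of L])
    fix z w :: complex assume "z \<in> cball 0 1" "w \<in> cball 0 1"
    then show "norm (f z - f w) \<le> L * norm (z - w)"
      using L by (intro differentiable_bound[OF convex_cball deriv]) (auto simp: norm_blinfun.rep_eq)
  qed
qed

lemma norm_cis_diff_squared: "(norm (cis a - cis b))\<^sup>2 = 2 * (1 - cos (a - b))"
proof -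
  have "(norm (cis a - cis b))\<^sup>2 = (cos a * cos a + sin a * sin a) + (cos b * cos b + sin b * sin b) - 2 * cos (a - b)"
    unfolding cmod_power2 cos_diff by (simp add: power2_eq_square algebra_simps del: sin_cos_squared_add3)
  then show ?thesis by simp
qed

text \<open>Twice each cosine defect is a squared chord length, so a Lipschitz constant of f
  supplies the \<open>M\<close> of \<open>poisson_by_parts_ge\<close>.\<close>

lemma cos_diff_lipschitz:
  fixes f :: "complex \<Rightarrow> complex"
  assumes lip: "\<And>z w. z \<in> cball 0 1 \<Longrightarrow> w \<in> cball 0 1 \<Longrightarrow> norm (f z - f w) \<le> L * norm (z - w)"
    and inner_f: "\<And>s t. inner (f (cis s)) (f (cis t)) = cos (\<phi> s - \<phi> t)"
  shows "1 - cos (\<phi> s - \<phi> t) \<le> L\<^sup>2 * (1 - cos (s - t))"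
proof -
  have "2 * (1 - cos (\<phi> s - \<phi> t)) = (norm (f (cis s) - f (cis t)))\<^sup>2"
    using inner_f[of s s] inner_f[of t t] inner_f[of s t]
    by (simp add: power2_norm_eq_inner inner_diff_left inner_diff_right inner_commute)
  also have "\<dots> \<le> (L * norm (cis s - cis t))\<^sup>2"
    by (intro power_mono lip) auto
  also have "\<dots> = 2 * (L\<^sup>2 * (1 - cos (s - t)))"
    by (simp add: power_mult_distrib norm_cis_diff_squared)
  finally show ?thesis by (simp only: mult_le_cancel_left_pos zero_less_numeral)
qed

text \<open>
  For \<open>r < 1\<close> this is the difference quotient \<open>f(cis t) \<bullet> (f(cis t) - f(r cis t)) / (1 - r)\<close>; the integral
  form extends it continuously to the radial derivative at \<open>r = 1\<close>.
\<close>

definition radial_quotient :: "(complex \<Rightarrow> complex) \<Rightarrow> (complex \<Rightarrow> complex \<Rightarrow>\<^sub>L complex) \<Rightarrow> real \<Rightarrow> real \<Rightarrow> real" where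
  "radial_quotient f Df r t =
     integral {0..1} (\<lambda>x. inner (f (cis t)) (Df (of_real (r + x * (1 - r)) * cis t) (cis t)))"

lemma radial_quotient_1: "radial_quotient f Df 1 t = inner (f (cis t)) (Df (cis t) (cis t))"
  by (simp add: radial_quotient_def)

lemma radial_segment: "0 \<le> r \<Longrightarrow> r \<le> 1 \<Longrightarrow> x \<in> {0..1} \<Longrightarrow> of_real (r + x * (1 - r)) * cis t \<in> cball (0::complex) 1"
proof -
  assume r: "0 \<le> r" "r \<le> 1" "x \<in> {0..1}"
  define y where "y = x * (1 - r)"
  have "x * (1 - r) \<le> 1 * (1 - r)" using r by (intro mult_right_mono) auto
  moreover have "0 \<le> x * (1 - r)" using r by simp
  ultimately have "\<bar>r + y\<bar> \<le> 1" using r by (simp only: y_def[symmetric] mult_1)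
  then show ?thesis by (simp add: y_def norm_mult del: of_real_add of_real_mult of_real_diff)
qed

lemma radial_quotient_eq:
  fixes f :: "complex \<Rightarrow> complex" and Df :: "complex \<Rightarrow> complex \<Rightarrow>\<^sub>L complex"
  assumes deriv: "\<And>z. z \<in> cball 0 1 \<Longrightarrow> (f has_derivative Df z) (at z within cball 0 1)"
    and r: "0 \<le> r" "r \<le> 1"
  shows "(1 - r) * radial_quotient f Df r t = inner (f (cis t)) (f (cis t) - f (of_real r * cis t))"
proof -
  define p where "p x = of_real (r + x * (1 - r)) * cis t" for x
  have p: "p x \<in> cball 0 1" if "x \<in> {0..1}" for x
    unfolding p_def by (rule radial_segment[OF r that])
  have "((\<lambda>x. inner (f (cis t)) (f (p x))) has_vector_derivative
      (1 - r) * inner (f (cis t)) (Df (p x) (cis t))) (at x within {0..1})" if x: "x \<in> {0..1}" for x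
  proof -
    have "(p has_derivative (\<lambda>h. h *\<^sub>R ((1 - r) *\<^sub>R cis t))) (at x within {0..1})"
      unfolding p_def[abs_def] by (auto intro!: derivative_eq_intros simp: scaleR_conv_of_real)
    moreover have "(f has_derivative Df (p x)) (at (p x) within p ` {0..1})"
      using p x by (intro has_derivative_subset[OF deriv]) auto
    ultimately have "((\<lambda>x. f (p x)) has_derivative (\<lambda>h. Df (p x) (h *\<^sub>R ((1 - r) *\<^sub>R cis t)))) (at x within {0..1})"
      by (rule has_derivative_in_compose)
    then have "((\<lambda>x. inner (f (cis t)) (f (p x))) has_derivative
       (\<lambda>h. inner (f (cis t)) (Df (p x) (h *\<^sub>R ((1 - r) *\<^sub>R cis t))))) (at x within {0..1})"
      by (rule bounded_linear.has_derivative[OF bounded_linear_inner_right])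
    then show ?thesis
      unfolding has_vector_derivative_def by (simp add: blinfun.scaleR_right mult.assoc)
  qed
  then have "((\<lambda>x. (1 - r) * inner (f (cis t)) (Df (p x) (cis t))) has_integral
     (inner (f (cis t)) (f (p 1)) - inner (f (cis t)) (f (p 0)))) {0..1}"
    by (intro fundamental_theorem_of_calculus) auto
  from integral_unique[OF this] show ?thesis
    by (simp add: radial_quotient_def p_def inner_diff_right)
qed

text \<open>Continuity up to r = 1 allows the limit under the integral over t, although the Poisson
  representation is available only for r < 1.\<close>

lemma continuous_on_radial_quotient:
  fixes f :: "complex \<Rightarrow> complex" and Df :: "complex \<Rightarrow> complex \<Rightarrow>\<^sub>L complex"
  assumes f: "continuous_on (cball 0 1) f" and C1: "continuous_on (cball 0 1) Df"
  shows "continuous_on ({0..1} \<times> S) (\<lambda>q. radial_quotient f Df (fst q) (snd q))"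
proof -
  have "continuous_on (({0..1} \<times> S) \<times> cbox 0 1)
     (\<lambda>(q, x). inner (f (cis (snd q))) (Df (of_real (fst q + x * (1 - fst q)) * cis (snd q)) (cis (snd q))))"
    unfolding case_prod_beta
  proof (intro continuous_intros continuous_on_compose2[OF f] continuous_on_compose2[OF C1])
    show "(\<lambda>y. of_real (fst (fst y) + snd y * (1 - fst (fst y))) * cis (snd (fst y))) ` (({0..1} \<times> S) \<times> cbox 0 1)
        \<subseteq> cball (0::complex) 1"
    proof (intro image_subsetI)
      fix y :: "(real \<times> real) \<times> real" assume "y \<in> ({0..1} \<times> S) \<times> cbox 0 1"
      then show "of_real (fst (fst y) + snd y * (1 - fst (fst y))) * cis (snd (fst y)) \<in> cball (0::complex) 1"
        by (intro radial_segment) auto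
    qed
  qed auto
  from integral_continuous_on_param[OF this] show ?thesis by (simp add: radial_quotient_def)
qed

text \<open>Take the inner product of the Poisson formula with f(cis t) and subtract it from the
  total mass of the kernel. The factor 1 - r of 1 - r^2 then cancels against the difference
  quotient, which leaves the numerator 1 + r.\<close>

lemma radial_quotient_poisson:
  fixes f :: "complex \<Rightarrow> complex" and Df :: "complex \<Rightarrow> complex \<Rightarrow>\<^sub>L complex"
  assumes harm: "harmonic_on f (ball 0 1)"
    and deriv: "\<And>z. z \<in> cball 0 1 \<Longrightarrow> (f has_derivative Df z) (at z within cball 0 1)"
    and inner_f: "\<And>s t. inner (f (cis s)) (f (cis t)) = cos (\<phi> s - \<phi> t)"
    and r: "0 \<le> r" "r < 1"
  shows "2 * pi * radial_quotient f Df r t =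
    integral {0..2*pi} (\<lambda>h. (1 + r) / poisson_denom r h * (1 - cos (\<phi> (t + h) - \<phi> t)))"
proof -
  have f_cont: "continuous_on (cball 0 1) f" using deriv by (rule has_derivative_continuous_on)
  have "continuous_on {0..2*pi} (\<lambda>h. ((1 - r\<^sup>2) / poisson_denom r h) *\<^sub>R f (cis (t + h)))"
    using poisson_denom_pos[OF r]
    by (intro continuous_intros continuous_on_compose2[OF f_cont]) (auto simp: less_imp_neq[symmetric])
  then have "((\<lambda>h. ((1 - r\<^sup>2) / poisson_denom r h) *\<^sub>R f (cis (t + h))) has_integral
       (2*pi) *\<^sub>R f (of_real r * cis t)) {0..2*pi}"
    using poisson_integral_harmonic[OF harm f_cont r, of t]
    by (simp add: integrable_continuous_interval has_integral_integrable_integral)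
  from has_integral_linear[OF this bounded_linear_inner_right, of "f (cis t)"]
  have 1: "((\<lambda>h. (1 - r\<^sup>2) / poisson_denom r h * cos (\<phi> (t + h) - \<phi> t)) has_integral
      2 * pi * inner (f (cis t)) (f (of_real r * cis t))) {0..2*pi}"
    by (simp add: o_def inner_f cos_minus[of "\<phi> t - \<phi> (t + _)", symmetric])
  have "((\<lambda>h. (1 - r\<^sup>2) / poisson_denom r h - (1 - r\<^sup>2) / poisson_denom r h * cos (\<phi> (t + h) - \<phi> t))
      has_integral (2 * pi - 2 * pi * inner (f (cis t)) (f (of_real r * cis t)))) {0..2*pi}"
    by (rule has_integral_diff[OF poisson_kernel_integral[OF r] 1])
  moreover have "(1 - r\<^sup>2) / poisson_denom r h - (1 - r\<^sup>2) / poisson_denom r h * cos (\<phi> (t + h) - \<phi> t)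
     = (1 - r) * ((1 + r) / poisson_denom r h * (1 - cos (\<phi> (t + h) - \<phi> t)))" for h
  proof -
    have "1 - r\<^sup>2 = (1 - r) * (1 + r)" by (simp add: power2_eq_square algebra_simps)
    then show ?thesis by (simp add: right_diff_distrib)
  qed
  moreover have "2 * pi - 2 * pi * inner (f (cis t)) (f (of_real r * cis t)) = 2 * pi * ((1 - r) * radial_quotient f Df r t)"
    using radial_quotient_eq[OF deriv, of r t] r inner_f[of t t] by (simp add: inner_diff_right right_diff_distrib)
  ultimately have "integral {0..2*pi} (\<lambda>h. (1 - r) * ((1 + r) / poisson_denom r h * (1 - cos (\<phi> (t + h) - \<phi> t))))
      = 2 * pi * ((1 - r) * radial_quotient f Df r t)"
    by (simp add: integral_unique)
  then have "(1 - r) * integral {0..2*pi} (\<lambda>h. (1 + r) / poisson_denom r h * (1 - cos (\<phi> (t + h) - \<phi> t)))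
      = (1 - r) * (2 * pi * radial_quotient f Df r t)"
    by (simp only: integral_mult_right mult.left_commute)
  then show ?thesis using r by (simp only: mult_cancel_left) simp
qed

lemma boundary_inequality:
  fixes f :: "complex \<Rightarrow> complex" and Df :: "complex \<Rightarrow> complex \<Rightarrow>\<^sub>L complex" and \<phi> w :: "real \<Rightarrow> real"
  assumes harm: "harmonic_on f (ball 0 1)"
    and deriv: "\<And>z. z \<in> cball 0 1 \<Longrightarrow> (f has_derivative Df z) (at z within cball 0 1)"
    and C1: "continuous_on (cball 0 1) Df"
    and \<phi>: "\<And>t. (\<phi> has_real_derivative w t) (at t)"
    and w: "continuous_on UNIV w" "\<And>t. 0 \<le> w t"
    and period: "\<And>t. \<phi> (t + 2*pi) = \<phi> t + 2*pi"
    and inner_f: "\<And>s t. inner (f (cis s)) (f (cis t)) = cos (\<phi> s - \<phi> t)"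
  shows "integral {0..2*pi} (\<lambda>t. integral {0..2*pi} (\<lambda>h. chord_gap h (\<phi> (t + h) - \<phi> t))) / 16
    \<le> 2 * pi * integral {0..2*pi} (\<lambda>t. (w t - 1) * inner (f (cis t)) (Df (cis t) (cis t)))"
proof -
  obtain L where lip: "\<And>z w. z \<in> cball 0 1 \<Longrightarrow> w \<in> cball 0 1 \<Longrightarrow> norm (f z - f w) \<le> L * norm (z - w)"
    using lipschitz_on_disc[OF deriv C1] by blast
  have f_cont: "continuous_on (cball 0 1) f" using deriv by (rule has_derivative_continuous_on)
  have \<phi>_cont: "continuous_on UNIV \<phi>" using \<phi> by (rule DERIV_continuous_on)
  note \<phi>w_cont = continuous_on_compose2[OF \<phi>_cont] continuous_on_compose2[OF w(1)]
  have mono: "\<phi> s \<le> \<phi> t" if "s \<le> t" for s t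
    by (rule DERIV_nonneg_imp_nondecreasing[OF that]) (use \<phi> w(2) in blast)
  have shift: "((\<lambda>h. \<phi> (t + h) - \<phi> t) has_real_derivative w (t + h)) (at h within S)" for t h S
  proof -
    have "((\<lambda>h. \<phi> (t + h)) has_real_derivative w (t + h) * 1) (at h within S)"
      by (rule DERIV_chain2[OF \<phi>]) (auto intro!: derivative_eq_intros)
    then show ?thesis by (auto intro!: derivative_eq_intros)
  qed
  define gap where "gap t = integral {0..2*pi} (\<lambda>h. chord_gap h (\<phi> (t + h) - \<phi> t))" for t
  define N where "N = integral {0..2*pi} gap"
  have gap_cont: "continuous_on S gap" for S
  proof -
    have "continuous_on (S \<times> cbox 0 (2*pi)) (\<lambda>(t, h). chord_gap h (\<phi> (t + h) - \<phi> t))"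
      unfolding case_prod_beta by (intro continuous_intros \<phi>w_cont) auto
    from integral_continuous_on_param[OF this] show ?thesis by (simp add: gap_def[abs_def])
  qed
  \<comment> \<open>The shifted density \<open>w (t + h)\<close> is the h-derivative of
    \<open>\<phi> (t + h) - \<phi> t\<close>, as integration by parts requires. \<open>J r t\<close>
    is bounded below for each t, but it is matched with the density \<open>w t\<close> only after
    integration over t.\<close>
  define J where "J r t = integral {0..2*pi} (\<lambda>h. (1 + r) / poisson_denom r h * ((w (t + h) - 1) * (1 - cos (\<phi> (t + h) - \<phi> t))))" for r t
  have J_ge: "gap t / 16 - 2 * pi * L\<^sup>2 * (1 - r) \<le> J r t" if r: "1/2 \<le> r" "r < 1" for r t
    unfolding gap_def J_def
  proof (rule poisson_by_parts_ge[OF r shift])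
    show "continuous_on {0..2*pi} (\<lambda>h. w (t + h))" by (intro continuous_intros \<phi>w_cont) auto
    show "\<phi> (t + 0) - \<phi> t = 0" "\<phi> (t + 2*pi) - \<phi> t = 2*pi" using period[of t] by simp_all
    show "\<phi> (t + h) - \<phi> t \<in> {0..2*pi}" if "h \<in> {0..2*pi}" for h
      using mono[of t "t + h"] mono[of "t + h" "t + 2*pi"] period[of t] that by simp
    show "1 - cos (\<phi> (t + h) - \<phi> t) \<le> L\<^sup>2 * (1 - cos h)" for h
      using cos_diff_lipschitz[OF lip inner_f, of "t + h" t] by simp
  qed auto
  define U where "U = radial_quotient f Df"
  have J_int: "integral {0..2*pi} (J r) = 2 * pi * integral {0..2*pi} (\<lambda>t. (w t - 1) * U r t)"
    if r: "0 \<le> r" "r < 1" for r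
  proof -
    note D = poisson_denom_pos[OF r]
    define k where "k h = (1 + r) / poisson_denom r h" for h
    have k_cont: "continuous_on S k" for S
      unfolding k_def using D by (intro continuous_intros) (auto simp: less_imp_neq[symmetric])
    define c where "c t h = 1 - cos (\<phi> (t + h) - \<phi> t)" for t h
    have cont: "continuous_on (cbox (0,0) (2*pi,2*pi)) (\<lambda>(t,h). k h * ((w t - 1) * c t h))"
        "continuous_on (cbox (0,0) (2*pi,2*pi)) (\<lambda>(h,t). k h * ((w (t + h) - 1) * c t h))"
      unfolding case_prod_beta c_def
      by (intro continuous_intros \<phi>w_cont continuous_on_compose2[OF k_cont[of UNIV]]; simp)+
    \<comment> \<open>The difference is the integral over a period of an exact derivative.\<close>
    have shift_int: "integral {0..2*pi} (\<lambda>t. (w t - 1) * c t h) = integral {0..2*pi} (\<lambda>t. (w (t + h) - 1) * c t h)" for h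
    proof -
      define E where "E t = (\<phi> (t + h) - \<phi> t) - sin (\<phi> (t + h) - \<phi> t)" for t
      have d: "(E has_real_derivative (w (t + h) - w t) * c t h) (at t within {0..2*pi})" for t
      proof -
        have "((\<lambda>t. \<phi> (t + h)) has_real_derivative w (t + h) * 1) (at t within {0..2*pi})"
          by (rule DERIV_chain2[OF \<phi>]) (auto intro!: derivative_eq_intros)
        moreover have "(\<phi> has_real_derivative w t) (at t within {0..2*pi})"
          using \<phi> by (rule has_field_derivative_at_within)
        ultimately have "((\<lambda>t. \<phi> (t + h) - \<phi> t) has_real_derivative (w (t + h) - w t)) (at t within {0..2*pi})"
          using DERIV_diff by fastforce
        moreover have "((\<lambda>t. X t - sin (X t)) has_real_derivative v * (1 - cos (X t))) (at t within S)"
          if "(X has_real_derivative v) (at t within S)" for X v t S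
          using that by (auto intro!: derivative_eq_intros simp: algebra_simps)
        ultimately show ?thesis unfolding E_def[abs_def] c_def by fastforce
      qed
      have "((\<lambda>t. (w (t + h) - w t) * c t h) has_integral (E (2*pi) - E 0)) {0..2*pi}"
        using d by (intro fundamental_theorem_of_calculus) (auto simp: has_real_derivative_iff_has_vector_derivative)
      moreover have "E (2*pi) = E 0"
        using period[of h] period[of 0] by (simp add: E_def add.commute)
      ultimately have "integral {0..2*pi} (\<lambda>t. (w (t + h) - w t) * c t h) = 0" by (simp add: integral_unique)
      moreover have "integral {0..2*pi} (\<lambda>t. (w (t + h) - w t) * c t h)
         = integral {0..2*pi} (\<lambda>t. (w (t + h) - 1) * c t h) - integral {0..2*pi} (\<lambda>t. (w t - 1) * c t h)"
        unfolding c_def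
        by (subst integral_diff[symmetric])
          (auto intro!: integrable_continuous_interval continuous_intros \<phi>w_cont integral_cong simp: algebra_simps)
      ultimately show ?thesis by simp
    qed
    have "2 * pi * integral {0..2*pi} (\<lambda>t. (w t - 1) * U r t) = integral {0..2*pi} (\<lambda>t. (w t - 1) * (2 * pi * U r t))"
      by (simp only: integral_mult_right[symmetric] ac_simps)
    also have "\<dots> = integral {0..2*pi} (\<lambda>t. integral {0..2*pi} (\<lambda>h. k h * ((w t - 1) * c t h)))"
    proof (rule integral_cong)
      fix t
      show "(w t - 1) * (2 * pi * U r t) = integral {0..2*pi} (\<lambda>h. k h * ((w t - 1) * c t h))"
      proof -
        have "2 * pi * U r t = integral {0..2*pi} (\<lambda>h. k h * c t h)"
          unfolding U_def k_def c_def by (rule radial_quotient_poisson[OF harm deriv inner_f r])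
        then show ?thesis by (simp only: integral_mult_right[symmetric] mult.left_commute)
      qed
    qed
    also have "\<dots> = integral {0..2*pi} (\<lambda>h. integral {0..2*pi} (\<lambda>t. k h * ((w t - 1) * c t h)))"
      using integral_swap_continuous[OF cont(1)] by simp
    also have "\<dots> = integral {0..2*pi} (\<lambda>h. integral {0..2*pi} (\<lambda>t. k h * ((w (t + h) - 1) * c t h)))"
      by (simp only: integral_mult_right shift_int)
    also have "\<dots> = integral {0..2*pi} (\<lambda>t. integral {0..2*pi} (\<lambda>h. k h * ((w (t + h) - 1) * c t h)))"
      using integral_swap_continuous[OF cont(2)] by simp
    finally show ?thesis by (simp add: J_def[abs_def] k_def c_def)
  qed
  \<comment> \<open>\<open>N\<close> does not depend on \<open>r\<close>, so the lower bound becomes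
    \<open>N / 16\<close> at r = 1, while \<open>G 1\<close> contains the true radial
    derivative.\<close>
  define F where "F r = N / 16 - 2 * pi * L\<^sup>2 * (1 - r) * (2 * pi)" for r
  define G where "G r = 2 * pi * integral {0..2*pi} (\<lambda>t. (w t - 1) * U r t)" for r
  have "F 1 \<le> G 1"
  proof (rule continuous_on_le_at_right_end[where a="1/2" and F=F and G=G])
    show "continuous_on {1/2..1} F" unfolding F_def by (intro continuous_intros)
    have "continuous_on ({0..1} \<times> cbox 0 (2*pi)) (\<lambda>(r, t). (w t - 1) * U r t)"
      unfolding case_prod_beta U_def
      by (intro continuous_intros \<phi>w_cont continuous_on_radial_quotient f_cont C1) auto
    from integral_continuous_on_param[OF this] have "continuous_on {0..1} G"
      unfolding G_def[abs_def] by (intro continuous_intros) simp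
    then show "continuous_on {1/2..1} G" by (rule continuous_on_subset) auto
    show "F r \<le> G r" if r: "1/2 \<le> r" "r < 1" for r
    proof -
      have "F r = integral {0..2*pi} (\<lambda>t. gap t / 16 - 2 * pi * L\<^sup>2 * (1 - r))"
        unfolding F_def N_def
        by (subst integral_diff) (auto intro!: integrable_continuous_interval continuous_intros gap_cont)
      also have "\<dots> \<le> integral {0..2*pi} (J r)"
      proof (rule integral_le)
        show "(\<lambda>t. gap t / 16 - 2 * pi * L\<^sup>2 * (1 - r)) integrable_on {0..2*pi}"
          by (intro integrable_continuous_interval continuous_intros gap_cont) auto
        have "continuous_on ({0..2*pi} \<times> cbox 0 (2*pi))
            (\<lambda>(t, h). (1 + r) / poisson_denom r h * ((w (t + h) - 1) * (1 - cos (\<phi> (t + h) - \<phi> t))))"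
          unfolding case_prod_beta using poisson_denom_pos[of r] r
          by (intro continuous_intros \<phi>w_cont) (auto simp: less_imp_neq[symmetric])
        from integral_continuous_on_param[OF this] show "J r integrable_on {0..2*pi}"
          by (intro integrable_continuous_interval) (simp add: J_def[abs_def])
        show "gap t / 16 - 2 * pi * L\<^sup>2 * (1 - r) \<le> J r t" for t by (rule J_ge[OF r])
      qed
      also have "\<dots> = G r" unfolding G_def using r by (intro J_int) auto
      finally show ?thesis .
    qed
  qed simp
  then show ?thesis
    by (simp add: F_def G_def N_def gap_def[abs_def] U_def radial_quotient_1)
qed

subsection \<open>Boundary values of homeomorphisms of the disc\<close>

text \<open>By invariance of domain the inverse maps the open ball onto an open subset of the closed
  ball, hence into the open ball. A boundary point with interior image would then be
  interior.\<close>

lemma homeomorphism_cball_sphere: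
  fixes f :: "'a::euclidean_space \<Rightarrow> 'a"
  assumes "homeomorphism (cball a r) (cball a r) f g" "z \<in> sphere a r"
  shows "f z \<in> sphere a r"
proof (rule ccontr)
  assume "f z \<notin> sphere a r"
  moreover have "z \<in> cball a r" using assms(2) by simp
  then have "f z \<in> cball a r" using assms(1) homeomorphism_image1 by blast
  ultimately have fz: "f z \<in> ball a r" by simp
  have "open (g ` ball a r)"
  proof (rule invariance_of_domain)
    show "continuous_on (ball a r) g"
      using assms(1) by (meson ball_subset_cball continuous_on_subset homeomorphism_def)
    show "inj_on g (ball a r)"
      using assms(1) by (metis ball_subset_cball homeomorphism_apply2 inj_on_inverseI subsetD)
  qed simp
  moreover have "g ` ball a r \<subseteq> cball a r"
    using assms(1) ball_subset_cball[of a r] by (auto simp: homeomorphism_def)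
  ultimately have "g ` ball a r \<subseteq> ball a r"
    by (metis interior_cball interior_maximal)
  moreover have "g (f z) = z"
    using assms by (metis homeomorphism_apply1 sphere_cball subsetD)
  ultimately have "z \<in> ball a r" using fz by (metis image_subset_iff)
  then show False using assms(2) by simp
qed

text \<open>Monotonicity on one period gives w \<ge> 0 there, and periodicity gives it everywhere.
  The increase of \<phi> over a period is 2 pi n with n \<ge> 1; if n were 2 or more, \<phi> would
  reach \<phi>(0) + 2 pi strictly before the period ends, against injectivity.\<close>

lemma increasing_lift:
  fixes \<phi> w :: "real \<Rightarrow> real"
  assumes \<phi>: "\<And>t. (\<phi> has_real_derivative w t) (at t)" and w: "continuous_on UNIV w"
    and period: "\<And>t. w (t + 2*pi) = w t"
    and inj: "inj_on (\<lambda>t. cis (\<phi> t)) {0..<2*pi}" and closed: "cis (\<phi> (2*pi)) = cis (\<phi> 0)"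
    and mono: "strict_mono_on {0..<2*pi} \<phi>"
  shows "0 \<le> w t" "\<phi> (t + 2*pi) = \<phi> t + 2*pi"
proof -
  have pos: "0 \<le> w t" if "t \<in> {0..2*pi}" for t
  proof (rule continuous_ge_on_closure[where S="{0<..<2*pi}" and f=w])
    show "continuous_on (closure {0<..<2*pi}) w" using w by (rule continuous_on_subset) auto
    show "t \<in> closure {0<..<2*pi}" using that by simp
    show "0 \<le> w x" if "x \<in> {0<..<2*pi}" for x
    proof (rule mono_on_imp_deriv_nonneg[OF _ \<phi>])
      show "mono_on {0..<2*pi} \<phi>" using mono by (rule strict_mono_on_imp_mono_on)
      show "x \<in> interior {0..<2*pi}" using that by simp
    qed
  qed
  have period_nat: "w (t + 2*pi * real n) = w t" for t n
  proof (induction n)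
    case (Suc n)
    have "w (t + 2*pi * real (Suc n)) = w ((t + 2*pi * real n) + 2*pi)" by (simp add: algebra_simps)
    then show ?case using Suc period by simp
  qed simp
  have period_int: "w (t + 2*pi * real_of_int k) = w t" for t k
  proof (cases "k \<ge> 0")
    case True
    then show ?thesis using period_nat[of t "nat k"] by simp
  next
    case False
    then show ?thesis using period_nat[of "t + 2*pi * real_of_int k" "nat (-k)"] by simp
  qed
  show w_nonneg: "0 \<le> w t" for t
  proof -
    define k where "k = \<lfloor>t / (2*pi)\<rfloor>"
    have "real_of_int k \<le> t / (2*pi)" "t / (2*pi) < real_of_int k + 1"
      by (auto simp: k_def)
    then have "real_of_int k * (2*pi) \<le> t" "t < (real_of_int k + 1) * (2*pi)"
      by (simp_all only: pos_le_divide_eq pos_divide_less_eq pi_gt_zero zero_less_mult_iff zero_less_numeral simp_thms)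
    then have "t + 2*pi * real_of_int (-k) \<in> {0..2*pi}" by (simp add: algebra_simps)
    from pos[OF this] show ?thesis by (simp only: period_int)
  qed
  have \<phi>_mono: "\<phi> s \<le> \<phi> t" if "s \<le> t" for s t
    by (rule DERIV_nonneg_imp_nondecreasing[OF that]) (use \<phi> w_nonneg in blast)
  obtain n :: int where n: "\<phi> (2*pi) = \<phi> 0 + 2*pi * n"
    using closed sin_cos_eq_iff[of "\<phi> (2*pi)" "\<phi> 0"] by (auto simp: complex_eq_iff)
  have "\<phi> 0 < \<phi> pi" using mono by (rule strict_mono_onD) auto
  also have "\<phi> pi \<le> \<phi> (2*pi)" by (rule \<phi>_mono) simp
  finally have "0 < 2*pi * real_of_int n" using n by simp
  then have "n \<ge> 1" by (simp add: zero_less_mult_iff)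
  moreover have "\<not> n \<ge> 2"
  proof
    assume "n \<ge> 2"
    then have "2 * pi * 2 \<le> 2 * pi * real_of_int n" by (intro mult_left_mono) auto
    then have le: "\<phi> 0 + 2*pi < \<phi> (2*pi)" using n pi_gt_zero by linarith
    have "continuous_on {0..2*pi} \<phi>" using \<phi> by (intro DERIV_continuous_on) (rule has_field_derivative_at_within)
    then obtain s where s: "0 \<le> s" "s \<le> 2*pi" "\<phi> s = \<phi> 0 + 2*pi"
      using IVT'[of \<phi> 0 "\<phi> 0 + 2*pi" "2*pi"] le by auto
    then have "s \<noteq> 2*pi" "s \<noteq> 0" using le by auto
    moreover have "cis (\<phi> s) = cis (\<phi> 0)" by (simp add: s(3) complex_eq_iff)
    ultimately show False using inj_onD[OF inj, of s 0] s by auto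
  qed
  ultimately have "n = 1" by simp
  moreover have "\<phi> (t + 2*pi) - \<phi> t = \<phi> (0 + 2*pi) - \<phi> 0"
  proof (rule DERIV_isconst_all[where f="\<lambda>t. \<phi> (t + 2*pi) - \<phi> t"], rule allI)
    fix t
    have "((\<lambda>t. \<phi> (t + 2*pi)) has_real_derivative w (t + 2*pi) * 1) (at t)"
      by (rule DERIV_chain2[OF \<phi>]) (auto intro!: derivative_eq_intros)
    from DERIV_diff[OF this \<phi>[of t]] show "((\<lambda>t. \<phi> (t + 2*pi) - \<phi> t) has_real_derivative 0) (at t)"
      by (simp add: period)
  qed
  ultimately show "\<phi> (t + 2*pi) = \<phi> t + 2*pi" using n by simp
qed

text \<open>A unit vector is orthogonal to its derivative, so F' is a real multiple w of i F. A
  primitive \<phi> of w with the right value at 0 makes F cis(-\<phi>) constant, so the lift comes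
  with its derivative.\<close>

lemma circle_map_lift:
  fixes F F' :: "real \<Rightarrow> complex"
  assumes F: "\<And>t. (F has_vector_derivative F' t) (at t)" and F': "continuous_on UNIV F'"
    and norm: "\<And>t. norm (F t) = 1"
  obtains \<phi> where "\<And>t. F t = cis (\<phi> t)" "\<And>t. (\<phi> has_real_derivative inner (\<i> * F t) (F' t)) (at t)"
    "\<And>t. F' t = inner (\<i> * F t) (F' t) *\<^sub>R (\<i> * F t)"
proof -
  define w where "w t = inner (\<i> * F t) (F' t)" for t
  have F_cont: "continuous_on UNIV F" using F
    by (meson continuous_at_imp_continuous_on has_vector_derivative_continuous)
  have orth: "inner (F t) (F' t) = 0" for t
  proof -
    have "((\<lambda>t. inner (F t) (F t)) has_vector_derivative inner (F t) (F' t) + inner (F' t) (F t)) (at t)"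
      by (rule bounded_bilinear.has_vector_derivative[OF bounded_bilinear_inner F F])
    moreover have "(\<lambda>t. inner (F t) (F t)) = (\<lambda>t. 1)" by (simp add: dot_square_norm norm)
    ultimately have "inner (F t) (F' t) + inner (F' t) (F t) = 0"
      using has_vector_derivative_const vector_derivative_unique_at by metis
    then show ?thesis by (simp add: inner_commute)
  qed
  have F'_eq: "F' t = w t *\<^sub>R (\<i> * F t)" for t
  proof -
    define a b c d where "a = Re (F t)" and "b = Im (F t)" and "c = Re (F' t)" and "d = Im (F' t)"
    have n: "a * a + b * b = 1" using norm[of t] cmod_power2[of "F t"] by (simp add: a_def b_def power2_eq_square)
    have o: "a * c + b * d = 0" using orth[of t] by (simp add: inner_complex_def a_def b_def c_def d_def)
    have "c = (a * a + b * b) * c - a * (a * c + b * d)" unfolding n o by simp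
    then have 1: "c = (a * d - b * c) * (- b)" by (simp add: algebra_simps)
    have "d = (a * a + b * b) * d - b * (a * c + b * d)" unfolding n o by simp
    then have 2: "d = (a * d - b * c) * a" by (simp add: algebra_simps)
    have "w t = a * d - b * c" by (simp add: w_def inner_complex_def a_def b_def c_def d_def)
    with 1 2 show ?thesis by (simp add: complex_eq_iff a_def b_def c_def d_def)
  qed
  have w_cont: "continuous_on UNIV w" unfolding w_def by (intro continuous_intros F_cont F')
  \<comment> \<open>Infinite endpoints give one antiderivative on the whole line.\<close>
  then have "\<exists>\<phi>0. \<forall>x. - \<infinity> < ereal x \<longrightarrow> ereal x < \<infinity> \<longrightarrow> (\<phi>0 has_vector_derivative w x) (at x)"
    by (intro einterval_antiderivative) (auto simp: continuous_on_eq_continuous_at)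
  then obtain \<phi>0 where \<phi>0: "\<And>t. (\<phi>0 has_vector_derivative w t) (at t)" by auto
  obtain \<theta> where \<theta>: "F 0 = cis \<theta>"
    using complex_norm_eq_1_exp[of "F 0"] norm[of 0] by (metis cis_conv_exp mult.commute norm_cis rcis_Ex rcis_def mult_1 of_real_1 complex_mod_rcis abs_1)
  define \<phi> where "\<phi> t = \<phi>0 t - \<phi>0 0 + \<theta>" for t
  have \<phi>: "(\<phi> has_real_derivative w t) (at t)" for t
    unfolding \<phi>_def has_real_derivative_iff_has_vector_derivative
    by (auto intro!: derivative_eq_intros \<phi>0)
  have "((\<lambda>t. F t * cis (- \<phi> t)) has_vector_derivative 0) (at t)" for t
  proof -
    have "((\<lambda>t. - \<phi> t) has_derivative (\<lambda>h. h * - w t)) (at t)"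
      by (rule has_derivative_eq_rhs[OF DERIV_minus[OF \<phi>[of t], unfolded has_field_derivative_def]]) auto
    then have "((\<lambda>t. cis (- \<phi> t)) has_vector_derivative (- w t) *\<^sub>R (\<i> * cis (- \<phi> t))) (at t)"
      using has_derivative_cis by (fastforce simp: has_vector_derivative_def)
    from has_vector_derivative_mult[OF F this] show ?thesis
      by (simp add: F'_eq algebra_simps)
  qed
  then obtain c where c: "\<And>t. F t * cis (- \<phi> t) = c"
    using has_vector_derivative_zero_constant[of UNIV "\<lambda>t. F t * cis (- \<phi> t)"] by auto
  have "c = 1" using c[of 0] by (simp add: \<phi>_def \<theta> cis_mult)
  have "F t = cis (\<phi> t)" for t
  proof -
    have "F t = F t * cis (- \<phi> t) * cis (\<phi> t)" by (simp add: mult.assoc cis_mult)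
    then show ?thesis by (simp add: c \<open>c = 1\<close>)
  qed
  then show thesis using \<phi> F'_eq unfolding w_def by (rule that)
qed

text \<open>The determinant can be taken in the positively oriented frame \<open>cis t\<close>,
  \<open>\<i> * cis t\<close>, and the determinant of v and i F is the inner product of F and
  v.\<close>

lemma jac_det_boundary:
  fixes L :: "complex \<Rightarrow>\<^sub>L complex"
  assumes "L (\<i> * cis t) = w *\<^sub>R (\<i> * F)"
  shows "jac_det L = w * inner F (L (cis t))"
proof -
  define a b where "a = L 1" and "b = L \<i>"
  have L: "L v = Re v *\<^sub>R a + Im v *\<^sub>R b" for v
    unfolding a_def b_def by (rule blinfun_complex_expand)
  define c s where "c = cos t" and "s = sin t"
  have "c * c + s * s = 1" by (simp add: c_def s_def)
  then have "jac_det L = (c * c + s * s) * (Re a * Im b - Im a * Re b)" by (simp add: jac_det_eq a_def b_def)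
  also have "\<dots> = Re (L (cis t)) * Im (L (\<i> * cis t)) - Im (L (cis t)) * Re (L (\<i> * cis t))"
    unfolding L by (simp add: c_def[symmetric] s_def[symmetric] algebra_simps)
  also have "\<dots> = w * inner F (L (cis t))"
    unfolding assms by (simp add: inner_complex_def algebra_simps)
  finally show ?thesis .
qed

lemma hs_norm2_ge_jac_det: "2 * \<bar>jac_det L\<bar> \<le> hs_norm2 L"
  using abs_triangle_ineq4[of "(cmod (wirt_z L))\<^sup>2" "(cmod (wirt_zbar L))\<^sup>2"]
  unfolding jac_det_def hs_norm2_def by simp

text \<open>The candidate \<open>K\<close> is real-linear, so it commutes with the Poisson integral
  of the identity map; f has the same boundary values, hence the same Poisson integral.\<close>

lemma rotation_from_boundary:
  assumes harm: "harmonic_on f (ball 0 1)" and cont: "continuous_on (cball 0 1) f"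
    and rot: "\<And>h. h \<in> {0..2*pi} \<Longrightarrow> f (cis h) = c * cis (\<sigma> * h)" and \<sigma>: "\<sigma> = 1 \<or> \<sigma> = -1"
    and z: "z \<in> cball 0 1"
  shows "f z = (if \<sigma> = 1 then c * z else c * cnj z)"
proof -
  define K where "K z = (if \<sigma> = 1 then c * z else c * cnj z)" for z
  have fK: "f (cis t) = K (cis t)" for t
  proof -
    obtain h where h: "h \<in> {0..2*pi}" "cis t = cis h"
    proof
      show "Arg2pi (cis t) \<in> {0..2*pi}" using Arg2pi[of "cis t"] by simp
      show "cis t = cis (Arg2pi (cis t))" using Arg2pi_eq[of "cis t"] by (simp add: cis_conv_exp)
    qed
    show ?thesis unfolding h(2) using rot[OF h(1)] \<sigma> by (auto simp: K_def cis_cnj)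
  qed
  have inner: "f (of_real r * cis t) = K (of_real r * cis t)" if r: "0 \<le> r" "r < 1" for r t
  proof -
    have "((\<lambda>h. ((1 - r\<^sup>2) / poisson_denom r h) *\<^sub>R (cis t * cis h)) has_integral
        (2*pi) *\<^sub>R (cis t * of_real r)) {0..2*pi}"
      by (rule poisson_integral_holomorphic[of "\<lambda>z. cis t * z", OF _ _ r]) (auto intro!: continuous_intros holomorphic_intros)
    moreover have "bounded_linear K"
      unfolding K_def using \<sigma>
      by (auto intro: bounded_linear_mult_right bounded_linear_compose[OF bounded_linear_mult_right bounded_linear_cnj])
    ultimately have "(K \<circ> (\<lambda>h. ((1 - r\<^sup>2) / poisson_denom r h) *\<^sub>R (cis t * cis h)) has_integral
        K ((2*pi) *\<^sub>R (cis t * of_real r))) {0..2*pi}"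
      by (rule has_integral_linear)
    then have "integral {0..2*pi} (\<lambda>h. ((1 - r\<^sup>2) / poisson_denom r h) *\<^sub>R f (cis (t + h))) = (2*pi) *\<^sub>R K (of_real r * cis t)"
      by (simp add: o_def linear_scale[OF bounded_linear.linear[OF \<open>bounded_linear K\<close>]] fK cis_mult integral_unique mult.commute[of "of_real r"])
    then show ?thesis
      unfolding poisson_integral_harmonic[OF harm cont r] by simp
  qed
  show ?thesis
  proof (cases "norm z < 1")
    case True
    have "z = of_real (norm z) * cis (Arg2pi z)" using Arg2pi_eq[of z] by (simp add: cis_conv_exp)
    then show ?thesis using inner[of "norm z" "Arg2pi z"] True by (simp add: K_def)
  next
    case False
    then have "norm z = 1" using z by simp
    then have "z = cis (Arg2pi z)" using Arg2pi_eq[of z] by (simp add: cis_conv_exp)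
    then show ?thesis using fK[of "Arg2pi z"] by (simp add: K_def)
  qed
qed

text \<open>The Jacobian enters only through its absolute value, so that the lemma also serves an
  orientation-reversing f, with the negated lift as \<phi>.\<close>

lemma boundary_rigidity:
  fixes f :: "complex \<Rightarrow> complex" and Df :: "complex \<Rightarrow> complex \<Rightarrow>\<^sub>L complex" and \<phi> w :: "real \<Rightarrow> real"
  assumes harm: "harmonic_on f (ball 0 1)"
    and deriv: "\<And>z. z \<in> cball 0 1 \<Longrightarrow> (f has_derivative Df z) (at z within cball 0 1)"
    and C1: "continuous_on (cball 0 1) Df"
    and \<phi>: "\<And>t. (\<phi> has_real_derivative w t) (at t)"
    and w: "continuous_on UNIV w" "\<And>t. 0 \<le> w t"
    and period: "\<And>t. \<phi> (t + 2*pi) = \<phi> t + 2*pi"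
    and inner_f: "\<And>s t. inner (f (cis s)) (f (cis t)) = cos (\<phi> s - \<phi> t)"
    and jac: "\<And>t. \<bar>jac_det (Df (cis t))\<bar> = \<bar>w t * inner (f (cis t)) (Df (cis t) (cis t))\<bar>"
  shows "integral (ball 0 1) (\<lambda>z. hs_norm2 (Df z)) \<le> integral {0..2*pi} (\<lambda>t. \<bar>jac_det (Df (cis t))\<bar>)"
    and "integral {0..2*pi} (\<lambda>t. \<bar>jac_det (Df (cis t))\<bar>) = integral (ball 0 1) (\<lambda>z. hs_norm2 (Df z)) \<Longrightarrow>
      h \<in> {0..2*pi} \<Longrightarrow> \<phi> h = \<phi> 0 + h"
proof -
  define u where "u t = inner (f (cis t)) (Df (cis t) (cis t))" for t
  have f_cont: "continuous_on (cball 0 1) f" using deriv by (rule has_derivative_continuous_on)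
  have \<phi>_cont: "continuous_on UNIV \<phi>" using \<phi> by (rule DERIV_continuous_on)
  have u_cont: "continuous_on S u" for S
    unfolding u_def by (intro continuous_intros continuous_on_compose2[OF f_cont] continuous_on_compose2[OF C1]) auto
  have w_cont: "continuous_on S w" for S using w(1) by (rule continuous_on_subset) simp
  have mono: "\<phi> s \<le> \<phi> t" if "s \<le> t" for s t
    by (rule DERIV_nonneg_imp_nondecreasing[OF that]) (use \<phi> w(2) in blast)
  have range: "\<phi> (t + h) - \<phi> t \<in> {0..2*pi}" if "h \<in> {0..2*pi}" for t h
    using mono[of t "t + h"] mono[of "t + h" "t + 2*pi"] period[of t] that by simp
  define gap where "gap t = integral {0..2*pi} (\<lambda>h. chord_gap h (\<phi> (t + h) - \<phi> t))" for t
  have gap_pos: "0 \<le> chord_gap h (\<phi> (t + h) - \<phi> t)" if "h \<in> {0..2*pi}" for t h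
    using range[OF that, of t] that by (intro chord_gap_nonneg) auto
  have gap_int_cont: "continuous_on S (\<lambda>h. chord_gap h (\<phi> (t + h) - \<phi> t))" for S t
    by (intro continuous_intros continuous_on_compose2[OF \<phi>_cont]) auto
  have gap_cont: "continuous_on S gap" for S
  proof -
    have "continuous_on (S \<times> cbox 0 (2*pi)) (\<lambda>(t, h). chord_gap h (\<phi> (t + h) - \<phi> t))"
      unfolding case_prod_beta by (intro continuous_intros continuous_on_compose2[OF \<phi>_cont]) auto
    from integral_continuous_on_param[OF this] show ?thesis by (simp add: gap_def[abs_def])
  qed
  have gap_nonneg: "0 \<le> gap t" for t
    unfolding gap_def by (rule integral_nonneg) (auto intro!: integrable_continuous_interval gap_int_cont gap_pos)
  have N: "0 \<le> integral {0..2*pi} gap"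
    by (rule integral_nonneg) (auto intro!: integrable_continuous_interval gap_cont gap_nonneg)
  have energy: "integral (ball 0 1) (\<lambda>z. hs_norm2 (Df z)) = integral {0..2*pi} u"
    unfolding u_def by (rule harmonic_energy[OF harm deriv C1])
  have split: "integral {0..2*pi} (\<lambda>t. (w t - 1) * u t) = integral {0..2*pi} (\<lambda>t. w t * u t) - integral {0..2*pi} u"
    by (subst integral_diff[symmetric])
      (auto intro!: integrable_continuous_interval continuous_intros w_cont u_cont integral_cong simp: algebra_simps)
  have "integral {0..2*pi} gap / 16 \<le> 2 * pi * integral {0..2*pi} (\<lambda>t. (w t - 1) * u t)"
    unfolding gap_def u_def by (rule boundary_inequality[OF harm deriv C1 \<phi> w period inner_f])
  then have key: "integral {0..2*pi} gap / 16 \<le> 2 * pi * (integral {0..2*pi} (\<lambda>t. w t * u t) - integral {0..2*pi} u)"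
    by (simp only: split)
  have jac': "integral {0..2*pi} (\<lambda>t. w t * u t) \<le> integral {0..2*pi} (\<lambda>t. \<bar>jac_det (Df (cis t))\<bar>)"
    unfolding jac u_def[symmetric]
    by (rule integral_le) (auto intro!: integrable_continuous_interval continuous_intros w_cont u_cont)
  have "0 \<le> 2 * pi * (integral {0..2*pi} (\<lambda>t. w t * u t) - integral {0..2*pi} u)"
    using N key by linarith
  then have "integral {0..2*pi} u \<le> integral {0..2*pi} (\<lambda>t. w t * u t)"
    using mult_le_cancel_left_pos[of "2*pi" 0 "integral {0..2*pi} (\<lambda>t. w t * u t) - integral {0..2*pi} u"] by simp
  with jac' energy show "integral (ball 0 1) (\<lambda>z. hs_norm2 (Df z)) \<le> integral {0..2*pi} (\<lambda>t. \<bar>jac_det (Df (cis t))\<bar>)"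
    by simp
  assume eq: "integral {0..2*pi} (\<lambda>t. \<bar>jac_det (Df (cis t))\<bar>) = integral (ball 0 1) (\<lambda>z. hs_norm2 (Df z))"
    and h: "h \<in> {0..2*pi}"
  have "integral {0..2*pi} (\<lambda>t. w t * u t) - integral {0..2*pi} u \<le> 0" using jac' eq energy by simp
  then have "2 * pi * (integral {0..2*pi} (\<lambda>t. w t * u t) - integral {0..2*pi} u) \<le> 0"
    by (intro mult_nonneg_nonpos) auto
  then have "integral {0..2*pi} gap = 0" using N key by linarith
  \<comment> \<open>One base point is enough: at t = 0 the vanishing already determines \<phi> on a
    full period.\<close>
  then have "gap 0 = 0"
    using integral_eq_0_iff[of 0 "2*pi" gap] gap_cont gap_nonneg by auto
  then have "\<forall>h\<in>{0..2*pi}. chord_gap h (\<phi> (0 + h) - \<phi> 0) = 0"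
    unfolding gap_def
    by (subst (asm) integral_eq_0_iff) (use gap_int_cont[of _ 0] gap_pos[of _ 0] in auto)
  then have zero: "chord_gap h (\<phi> h - \<phi> 0) = 0" using h by simp
  show "\<phi> h = \<phi> 0 + h"
  proof (cases "h = 0 \<or> h = 2*pi")
    case True
    then show ?thesis using period[of 0] by auto
  next
    case False
    then show ?thesis
      using chord_gap_pos[of h "\<phi> h - \<phi> 0"] zero range[OF h, of 0] h by force
  qed
qed

theorem theorem1p6:
  fixes f :: "complex \<Rightarrow> complex"
    and Df :: "complex \<Rightarrow> (complex \<Rightarrow>\<^sub>L complex)"
  assumes homeo: "\<exists>g. homeomorphism (cball 0 1) (cball 0 1) f g"
    and harm: "harmonic_on f (ball 0 1)"
    and deriv: "\<forall>z\<in>cball 0 1. (f has_derivative blinfun_apply (Df z)) (at z within cball 0 1)"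
    and C1: "continuous_on (cball 0 1) Df"
  shows "integral {0..2*pi} (\<lambda>t. \<bar>jac_det (Df (cis t))\<bar>)
           \<ge> integral (ball 0 1) (\<lambda>z. hs_norm2 (Df z))
       \<and> integral (ball 0 1) (\<lambda>z. hs_norm2 (Df z))
           \<ge> 2 * integral (ball 0 1) (\<lambda>z. \<bar>jac_det (Df z)\<bar>)
       \<and> 2 * integral (ball 0 1) (\<lambda>z. \<bar>jac_det (Df z)\<bar>) = 2 * pi
       \<and> (integral {0..2*pi} (\<lambda>t. \<bar>jac_det (Df (cis t))\<bar>)
             = integral (ball 0 1) (\<lambda>z. hs_norm2 (Df z))
           \<longrightarrow> (\<forall>z\<in>cball 0 1. \<forall>w\<in>cball 0 1. dist (f z) (f w) = dist z w))"
proof -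
  obtain g where g: "homeomorphism (cball 0 1) (cball 0 1) f g" using homeo by blast
  have deriv': "(f has_derivative Df z) (at z within cball 0 1)" if "z \<in> cball 0 1" for z
    using deriv that by blast
  have f_cont: "continuous_on (cball 0 1) f" using deriv' by (rule has_derivative_continuous_on)
  have f_inj: "inj_on f (cball 0 1)" using g by (metis homeomorphism_apply1 inj_on_inverseI)
  have f_img: "f ` cball 0 1 = cball 0 1" using g by (rule homeomorphism_image1)
  have area: "((\<lambda>z. \<bar>jac_det (Df z)\<bar>) has_integral pi) (ball 0 1)"
    by (rule jacobian_integral_over_disc[OF f_img f_inj deriv'])
  have hs_int: "(\<lambda>z. hs_norm2 (Df z)) integrable_on ball 0 1"
  proof -
    have "(\<lambda>z. hs_norm2 (Df z)) integrable_on cball 0 1"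
      by (intro set_lebesgue_integral_eq_integral(1) absolutely_integrable_on_continuous_compact continuous_intros C1) auto
    then show ?thesis
      by (subst (asm) integrable_spike_set_eq[where T="ball 0 1"])
        (auto intro: negligible_subset[OF negligible_sphere[of 0 1]])
  qed
  have "integral (ball 0 1) (\<lambda>z. 2 * \<bar>jac_det (Df z)\<bar>) \<le> integral (ball 0 1) (\<lambda>z. hs_norm2 (Df z))"
    using area hs_int by (intro integral_le hs_norm2_ge_jac_det integrable_on_mult_right) auto
  then have second: "2 * integral (ball 0 1) (\<lambda>z. \<bar>jac_det (Df z)\<bar>) \<le> integral (ball 0 1) (\<lambda>z. hs_norm2 (Df z))"
    by simp
  define F where "F t = f (cis t)" for t
  define F' where "F' t = Df (cis t) (\<i> * cis t)" for t
  have F_deriv: "(F has_vector_derivative F' t) (at t)" for t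
  proof -
    have "(cis has_derivative (\<lambda>h. h *\<^sub>R (\<i> * cis t))) (at t)"
      by (auto intro!: derivative_eq_intros)
    \<comment> \<open>f is differentiable only relative to the closed disc, but the curve
      \<open>cis\<close> stays in it, so the composite has a genuine derivative in t.\<close>
    moreover have "(f has_derivative Df (cis t)) (at (cis t) within range cis)"
      by (rule has_derivative_subset[OF deriv']) auto
    ultimately have "((\<lambda>t. f (cis t)) has_derivative (\<lambda>h. Df (cis t) (h *\<^sub>R (\<i> * cis t)))) (at t)"
      by (rule has_derivative_in_compose)
    then show ?thesis by (simp add: F_def[abs_def] F'_def has_vector_derivative_def blinfun.scaleR_right)
  qed
  have F'_cont: "continuous_on UNIV F'"
    unfolding F'_def by (intro continuous_intros continuous_on_compose2[OF C1]) auto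
  have F_norm: "norm (F t) = 1" for t
    using homeomorphism_cball_sphere[OF g, of "cis t"] by (simp add: F_def)
  obtain \<phi> where F_eq: "\<And>t. F t = cis (\<phi> t)"
    and \<phi>: "\<And>t. (\<phi> has_real_derivative inner (\<i> * F t) (F' t)) (at t)"
    and F'_eq: "\<And>t. F' t = inner (\<i> * F t) (F' t) *\<^sub>R (\<i> * F t)"
    using circle_map_lift[OF F_deriv F'_cont F_norm] by blast
  define w where "w t = inner (\<i> * F t) (F' t)" for t
  have w_cont: "continuous_on UNIV w"
    unfolding w_def F_def by (intro continuous_intros F'_cont continuous_on_compose2[OF f_cont]) auto
  have \<phi>w: "(\<phi> has_real_derivative w t) (at t)" for t using \<phi> by (simp add: w_def)
  have \<phi>_cont: "continuous_on S \<phi>" for S using \<phi>w by (intro DERIV_continuous_on) (rule has_field_derivative_at_within)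
  have cis_period: "cis (t + 2*pi) = cis t" for t by (simp add: complex_eq_iff)
  have w_period: "w (t + 2*pi) = w t" for t by (simp only: w_def F_def F'_def cis_period)
  have F_inj: "inj_on F {0..<2*pi}"
  proof (rule inj_onI)
    fix s t assume st: "s \<in> {0..<2*pi}" "t \<in> {0..<2*pi}" and "F s = F t"
    then have "cis s = cis t" using inj_onD[OF f_inj, of "cis s" "cis t"] by (simp add: F_def)
    moreover have "Arg2pi (cis x) = x" if "x \<in> {0..<2*pi}" for x
      using that by (intro Arg2pi_unique[of 1]) (auto simp: cis_conv_exp)
    ultimately show "s = t" using st by metis
  qed
  have \<phi>_inj: "inj_on \<phi> {0..<2*pi}"
    using F_inj by (auto simp: inj_on_def F_eq)
  have inner_f: "inner (f (cis s)) (f (cis t)) = cos (\<phi> s - \<phi> t)" for s t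
    using F_eq by (simp add: F_def[symmetric] inner_complex_def cos_diff)
  have jac: "jac_det (Df (cis t)) = w t * inner (f (cis t)) (Df (cis t) (cis t))" for t
    using jac_det_boundary[of "Df (cis t)" t "w t" "F t"] F'_eq[of t] by (simp add: F'_def w_def F_def)
  have closed: "cis (\<phi> (2*pi)) = cis (\<phi> 0)" using F_eq[of 0] F_eq[of "2*pi"] by (simp add: F_def)
  \<comment> \<open>\<sigma> is the orientation: \<sigma> \<phi> is the increasing lift. Changing
    the sign of \<phi> and w affects neither the cosines nor the absolute Jacobian.\<close>
  have main: "integral (ball 0 1) (\<lambda>z. hs_norm2 (Df z)) \<le> integral {0..2*pi} (\<lambda>t. \<bar>jac_det (Df (cis t))\<bar>) \<and>
     (integral {0..2*pi} (\<lambda>t. \<bar>jac_det (Df (cis t))\<bar>) = integral (ball 0 1) (\<lambda>z. hs_norm2 (Df z)) \<longrightarrow>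
       (\<forall>h\<in>{0..2*pi}. \<phi> h = \<phi> 0 + \<sigma> * h))"
    if \<sigma>: "\<sigma> = 1 \<or> \<sigma> = -1" and mono: "strict_mono_on {0..<2*pi} (\<lambda>t. \<sigma> * \<phi> t)" for \<sigma>
  proof -
    have d: "((\<lambda>t. \<sigma> * \<phi> t) has_real_derivative \<sigma> * w t) (at t)" for t
      by (rule DERIV_cmult[OF \<phi>w])
    have c: "continuous_on UNIV (\<lambda>t. \<sigma> * w t)" by (intro continuous_intros w_cont)
    have cis_\<sigma>: "cis (\<sigma> * x) = cis (\<sigma> * y) \<longleftrightarrow> cis x = cis y" for x y
      using \<sigma> by (auto simp: complex_eq_iff)
    have inj: "inj_on (\<lambda>t. cis (\<sigma> * \<phi> t)) {0..<2*pi}"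
      using F_inj unfolding inj_on_def F_eq cis_\<sigma> .
    have per: "\<sigma> * w (t + 2*pi) = \<sigma> * w t" for t by (simp only: w_period)
    have cl: "cis (\<sigma> * \<phi> (2*pi)) = cis (\<sigma> * \<phi> 0)" using closed by (simp only: cis_\<sigma>)
    note lift = increasing_lift[OF d c per inj cl mono]
    have i: "inner (f (cis s)) (f (cis t)) = cos (\<sigma> * \<phi> s - \<sigma> * \<phi> t)" for s t
      using \<sigma> by (auto simp: inner_f cos_diff)
    have j: "\<bar>jac_det (Df (cis t))\<bar> = \<bar>\<sigma> * w t * inner (f (cis t)) (Df (cis t) (cis t))\<bar>" for t
      using \<sigma> by (auto simp: jac)
    note rig = boundary_rigidity[OF harm deriv' C1 d c lift i j]
    have "\<phi> h = \<phi> 0 + \<sigma> * h" if "\<sigma> * \<phi> h = \<sigma> * \<phi> 0 + h" for h using \<sigma> that by auto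
    then show ?thesis using rig by blast
  qed
  \<comment> \<open>A continuous injective real function on an interval is strictly monotone; this
    decides the orientation.\<close>
  have "strict_mono_on {0..<2*pi} \<phi> \<or> strict_antimono_on {0..<2*pi} \<phi>"
    using \<phi>_inj injective_eq_monotone_map[of "{0..<2*pi}" \<phi>] \<phi>_cont is_interval_co by blast
  then have "strict_mono_on {0..<2*pi} (\<lambda>t. 1 * \<phi> t) \<or> strict_mono_on {0..<2*pi} (\<lambda>t. (-1) * \<phi> t)"
    by (auto simp: monotone_on_def)
  then obtain \<sigma> :: real where \<sigma>: "\<sigma> = 1 \<or> \<sigma> = -1" and mono: "strict_mono_on {0..<2*pi} (\<lambda>t. \<sigma> * \<phi> t)"
    by blast
  note main = main[OF \<sigma> mono]
  have rigid: "dist (f z) (f z') = dist z z'"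
    if eq: "integral {0..2*pi} (\<lambda>t. \<bar>jac_det (Df (cis t))\<bar>) = integral (ball 0 1) (\<lambda>z. hs_norm2 (Df z))"
      and z: "z \<in> cball 0 1" "z' \<in> cball 0 1" for z z'
  proof -
    have "\<forall>h\<in>{0..2*pi}. \<phi> h = \<phi> 0 + \<sigma> * h" using main eq by blast
    then have boundary: "f (cis h) = cis (\<phi> 0) * cis (\<sigma> * h)" if "h \<in> {0..2*pi}" for h
      using that F_eq[of h] by (simp only: F_def cis_mult)
    have rot: "f z = (if \<sigma> = 1 then cis (\<phi> 0) * z else cis (\<phi> 0) * cnj z)" if "z \<in> cball 0 1" for z
      by (rule rotation_from_boundary[OF harm f_cont _ \<sigma> that]) (rule boundary)
    have "dist (f z) (f z') = norm (if \<sigma> = 1 then cis (\<phi> 0) * (z - z') else cis (\<phi> 0) * cnj (z - z'))"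
      unfolding rot[OF z(1)] rot[OF z(2)] dist_norm by (simp add: algebra_simps)
    also have "\<dots> = dist z z'" by (cases "\<sigma> = 1") (simp_all add: norm_mult dist_norm del: complex_cnj_diff)
    finally show ?thesis .
  qed
  from integral_unique[OF area] have "2 * integral (ball 0 1) (\<lambda>z. \<bar>jac_det (Df z)\<bar>) = 2 * pi"
    by simp
  with main second rigid show ?thesis by blast
qed

end
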